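(* Let $\beta>0$, $g\in L^2(\mathbb{R})$, $\Lambda\subset\mathbb{R}$, and let $c_\lambda\in\mathbb{R}$, $\lambda\in\Lambda$, be real numbers. Put $$\Gamma=\bigcup_{\lambda\in\Lambda}\{\lambda\}\times(\beta\mathbb{Z}+c_\lambda)\subset\mathbb{R}^2,$$ and assume that $\Gamma$ is a discrete set. For $x\in\mathbb{R}$ consider the infinite matrix $$G_x=\left\{g\left(x+\frac{n}{\beta}-\lambda\right)e^{2\pi i c_\lambda\frac{n}{\beta}}\right\}_{\lambda\in\Lambda,\,n\in\mathbb{Z}}.$$ The system $\mathcal{G}(g;\Gamma)$ is a frame for $L^2(\mathbb{R})$ if and only if there exist $A,B>0$ such that for almost all $x\in\mathbb{R}$ and all $v\in\ell^2(\mathbb{Z})$ we have $$A\beta\,\|v\|_{\ell^2(\mathbb{Z})}^2\le\|G_xv\|_{\ell^2(\Lambda)}^2\le B\beta\,\|v\|_{\ell^2(\mathbb{Z})}^2.$$ Moreover, in this case the best possible $A$ and $B$ (the largest $A$ and the smallest $B$ for which these inequalities hold for almost all $x$ and all $v$) are respectively the best (optimal) lower and upper frame bounds for the system $\mathcal{G}(g;\Gamma)$.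
   Context: For $g\in L^2(\mathbb{R})$ and $t,\omega\in\mathbb{R}$ put $\pi_{t,\omega}g(x)=e^{2\pi i\omega x}g(x-t)$. For a discrete set $\Gamma\subset\mathbb{R}^2$ the generalized Gabor system is $\mathcal{G}(g;\Gamma)=\{\pi_{t,\omega}g\}_{(t,\omega)\in\Gamma}$. It is a frame for $L^2(\mathbb{R})$ if there are constants $A,B>0$ (lower and upper frame bounds) such that for all $h\in L^2(\mathbb{R})$, $A\|h\|^2\le\sum_{(t,\omega)\in\Gamma}|(h,\pi_{t,\omega}g)|^2\le B\|h\|^2$, where $(\cdot,\cdot)$ and $\|\cdot\|$ are the inner product and norm of $L^2(\mathbb{R})$. The matrix $G_x$ has rows indexed by $\Lambda$ and columns indexed by $\mathbb{Z}$, and acts by $(G_xv)_\lambda=\sum_{n\in\mathbb{Z}}g(x+\frac{n}{\beta}-\lambda)e^{2\pi i c_\lambda\frac{n}{\beta}}v_n$. *)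

theory Defs
  imports "HOL-Analysis.Analysis"
begin

text \<open>Elements of \<open>L\<^sup>2(\<real>)\<close> are handled through Lebesgue measurable representatives.\<close>

definition L2 :: "(real \<Rightarrow> complex) set" where
  "L2 = {f. f \<in> borel_measurable lebesgue \<and> integrable lebesgue (\<lambda>x. (cmod (f x))\<^sup>2)}"

definition L2_inner :: "(real \<Rightarrow> complex) \<Rightarrow> (real \<Rightarrow> complex) \<Rightarrow> complex" where
  "L2_inner f h = (LINT x|lebesgue. f x * cnj (h x))"

definition L2_norm :: "(real \<Rightarrow> complex) \<Rightarrow> real" where
  "L2_norm f = sqrt (LINT x|lebesgue. (cmod (f x))\<^sup>2)"

definition ell2 :: "'i set \<Rightarrow> ('i \<Rightarrow> complex) set" where
  "ell2 I = {v. (\<lambda>i. (cmod (v i))\<^sup>2) summable_on I}"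

definition ell2_norm :: "'i set \<Rightarrow> ('i \<Rightarrow> complex) \<Rightarrow> real" where
  "ell2_norm I v = sqrt (\<Sum>\<^sub>\<infinity>i\<in>I. (cmod (v i))\<^sup>2)"

text \<open>The squared \<open>\<ell>\<^sup>2\<close>-norm of an arbitrary family, equal to \<open>\<infinity>\<close> outside \<open>\<ell>\<^sup>2(I)\<close>.  It is used for
  families whose membership in \<open>\<ell>\<^sup>2\<close> is not known beforehand: a real-valued \<open>infsum\<close> would be \<open>0\<close>
  for a divergent sum, so that upper bounds would hold for it vacuously.\<close>

definition ell2_normsq_ext :: "'i set \<Rightarrow> ('i \<Rightarrow> complex) \<Rightarrow> ennreal" where
  "ell2_normsq_ext I v = (\<Sum>\<^sub>\<infinity>i\<in>I. ennreal ((cmod (v i))\<^sup>2))"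

definition time_freq_shift :: "real \<Rightarrow> real \<Rightarrow> (real \<Rightarrow> complex) \<Rightarrow> real \<Rightarrow> complex" where
  "time_freq_shift t \<omega> g x = cis (2 * pi * \<omega> * x) * g (x - t)"

text \<open>The Gabor system is the family \<open>(time_freq_shift t \<omega> g)\<close> indexed by \<open>(t, \<omega>) \<in> \<Gamma>\<close>; below is the
  family of its coefficients \<open>(h, \<pi>\<^bsub>t,\<omega>\<^esub> g)\<close>.\<close>

definition gabor_coeff ::
    "(real \<Rightarrow> complex) \<Rightarrow> (real \<Rightarrow> complex) \<Rightarrow> real \<times> real \<Rightarrow> complex" where
  "gabor_coeff g h = (\<lambda>(t, \<omega>). L2_inner h (time_freq_shift t \<omega> g))"

definition gabor_frame :: "(real \<Rightarrow> complex) \<Rightarrow> (real \<times> real) set \<Rightarrow> bool" where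
  "gabor_frame g \<Gamma> \<longleftrightarrow> (\<exists>A B. A > 0 \<and> B > 0 \<and> (\<forall>h\<in>L2.
     ennreal (A * (L2_norm h)\<^sup>2) \<le> ell2_normsq_ext \<Gamma> (gabor_coeff g h) \<and>
     ell2_normsq_ext \<Gamma> (gabor_coeff g h) \<le> ennreal (B * (L2_norm h)\<^sup>2)))"

definition lower_frame_bounds :: "(real \<Rightarrow> complex) \<Rightarrow> (real \<times> real) set \<Rightarrow> real set" where
  "lower_frame_bounds g \<Gamma> = {A. A > 0 \<and> (\<forall>h\<in>L2.
     ennreal (A * (L2_norm h)\<^sup>2) \<le> ell2_normsq_ext \<Gamma> (gabor_coeff g h))}"

definition upper_frame_bounds :: "(real \<Rightarrow> complex) \<Rightarrow> (real \<times> real) set \<Rightarrow> real set" where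
  "upper_frame_bounds g \<Gamma> = {B. B > 0 \<and> (\<forall>h\<in>L2.
     ell2_normsq_ext \<Gamma> (gabor_coeff g h) \<le> ennreal (B * (L2_norm h)\<^sup>2))}"

definition semi_regular_set :: "real \<Rightarrow> real set \<Rightarrow> (real \<Rightarrow> real) \<Rightarrow> (real \<times> real) set" where
  "semi_regular_set \<beta> \<Lambda> c = (\<Union>l\<in>\<Lambda>. {l} \<times> range (\<lambda>k::int. \<beta> * of_int k + c l))"

definition gabor_matrix ::
    "real \<Rightarrow> (real \<Rightarrow> complex) \<Rightarrow> (real \<Rightarrow> real) \<Rightarrow> real \<Rightarrow> real \<Rightarrow> int \<Rightarrow> complex" where
  "gabor_matrix \<beta> g c x l n = g (x + of_int n / \<beta> - l) * cis (2 * pi * c l * (of_int n / \<beta>))"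

text \<open>For \<open>g \<in> L\<^sup>2(\<real>)\<close> and \<open>v \<in> \<ell>\<^sup>2(\<int>)\<close>, each row sum converges absolutely for almost every \<open>x\<close>;
  the default value of \<open>infsum\<close> matters only for the remaining \<open>x\<close>.\<close>

definition gabor_matrix_apply ::
    "real \<Rightarrow> (real \<Rightarrow> complex) \<Rightarrow> (real \<Rightarrow> real) \<Rightarrow> real \<Rightarrow> (int \<Rightarrow> complex) \<Rightarrow> real \<Rightarrow> complex" where
  "gabor_matrix_apply \<beta> g c x v l = (\<Sum>\<^sub>\<infinity>n. gabor_matrix \<beta> g c x l n * v n)"

definition lower_matrix_bounds ::
    "real \<Rightarrow> (real \<Rightarrow> complex) \<Rightarrow> real set \<Rightarrow> (real \<Rightarrow> real) \<Rightarrow> real set" where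
  "lower_matrix_bounds \<beta> g \<Lambda> c = {A. A > 0 \<and> (AE x in lebesgue. \<forall>v\<in>ell2 UNIV.
     ennreal (A * \<beta> * (ell2_norm UNIV v)\<^sup>2) \<le> ell2_normsq_ext \<Lambda> (gabor_matrix_apply \<beta> g c x v))}"

definition upper_matrix_bounds ::
    "real \<Rightarrow> (real \<Rightarrow> complex) \<Rightarrow> real set \<Rightarrow> (real \<Rightarrow> real) \<Rightarrow> real set" where
  "upper_matrix_bounds \<beta> g \<Lambda> c = {B. B > 0 \<and> (AE x in lebesgue. \<forall>v\<in>ell2 UNIV.
     ell2_normsq_ext \<Lambda> (gabor_matrix_apply \<beta> g c x v) \<le> ennreal (B * \<beta> * (ell2_norm UNIV v)\<^sup>2))}"

definition is_greatest_of :: "'a::order \<Rightarrow> 'a set \<Rightarrow> bool" where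
  "is_greatest_of a S \<longleftrightarrow> a \<in> S \<and> (\<forall>s\<in>S. s \<le> a)"

definition is_least_of :: "'a::order \<Rightarrow> 'a set \<Rightarrow> bool" where
  "is_least_of a S \<longleftrightarrow> a \<in> S \<and> (\<forall>s\<in>S. a \<le> s)"

end

theory Submission
  imports Defs
begin

text \<open>
  Fix \<open>l \<in> \<Lambda>\<close>. The points of \<open>\<Gamma>\<close> over \<open>l\<close> are \<open>(l, \<beta> * k + c l)\<close> with \<open>k \<in> \<int>\<close>, so the coefficients of
  \<open>h\<close> at these points are integrals of one integrable function against exponentials of period \<open>1/\<beta>\<close>. Cutting
  the line into periods and summing turns them into the Fourier coefficients of a periodic function, and this
  function is, up to a unimodular factor and conjugation, the entry \<open>l\<close> of the matrix \<open>G\<^sub>x\<close> applied to the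
  fiber of \<open>h\<close>, the vector with entries \<open>cnj (h (x + n/\<beta>))\<close> (\<open>gabor_coeff_eq_Fourier\<close> and
  \<open>gabor_matrix_apply_fiber\<close>). By Parseval's identity and summation over \<open>l\<close>, \<open>\<beta>\<close> times the sum of the squared
  coefficients is the integral over one period of the squared norm of \<open>G\<^sub>x\<close> applied to the fiber
  (\<open>fiber_identity\<close>), while the squared norm of \<open>h\<close> is the integral of the squared norm of the fiber
  (\<open>fiber_norm\<close>).

  Bounds for almost every \<open>G\<^sub>x\<close> therefore integrate to frame bounds with the same constants. Conversely, the
  fibers of \<open>h\<close> can be prescribed: for a finitely supported vector \<open>w\<close> and a measurable subset \<open>E\<close> of the period
  there is an \<open>h\<close> with fiber \<open>w\<close> over \<open>E\<close> and \<open>0\<close> elsewhere. The frame inequalities for all these \<open>h\<close>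
  compare integrals over all \<open>E\<close>, hence give the matrix inequalities for \<open>w\<close> at almost every \<open>x\<close>
  (\<open>frame_bounds_imp_matrix_bounds_finite\<close>). The exceptional null set depends on \<open>w\<close>, so this is done for a
  countable dense set of vectors and extended by continuity (\<open>matrix_bounds_dense_extend\<close>). Hence frame bounds
  and matrix bounds are the same numbers, and extremal ones exist because they are cut out by non-strict
  inequalities.

  Parseval's identity is proved here for square integrable functions. That suffices: an upper matrix bound makes
  the periodized functions square integrable, and for the test functions of the converse direction they are
  finite combinations of translates of \<open>g\<close>.
\<close>

section \<open>Square sums\<close>

text \<open>Sums over countable sets become integrals against counting measure, so that the theorems of Tonelli
  and Fubini govern every exchange of sum and integral below.\<close>

lemma infsum_ennreal_eq_nn_integral:
  fixes f :: "'i \<Rightarrow> ennreal"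
  assumes "countable A"
  shows "infsum f A = (\<integral>\<^sup>+i. f i \<partial>count_space A)"
proof (cases "finite A")
  case True
  then show ?thesis by (simp add: nn_integral_count_space_finite)
next
  case False
  have bij: "bij_betw (from_nat_into A) UNIV A"
    using assms False by (rule bij_betw_from_nat_into)
  have nat: "infsum g UNIV = suminf g" for g :: "nat \<Rightarrow> ennreal"
    by (intro sums_unique has_sum_imp_sums has_sum_infsum nonneg_summable_on_complete) simp
  have "infsum f A = infsum (\<lambda>n. f (from_nat_into A n)) UNIV"
    by (simp add: infsum_reindex_bij_betw[OF bij])
  also have "\<dots> = (\<integral>\<^sup>+n. f (from_nat_into A n) \<partial>count_space UNIV)"
    by (simp add: nat nn_integral_count_space_nat)
  also have "\<dots> = (\<integral>\<^sup>+i. f i \<partial>count_space A)"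
    by (rule nn_integral_bij_count_space[OF bij])
  finally show ?thesis .
qed

lemma ell2_normsq_ext_eq_nn_integral:
  "countable I \<Longrightarrow> ell2_normsq_ext I v = (\<integral>\<^sup>+i. ennreal ((cmod (v i))\<^sup>2) \<partial>count_space I)"
  unfolding ell2_normsq_ext_def by (rule infsum_ennreal_eq_nn_integral)

lemma ell2_normsq_ext_eq_SUP:
  "ell2_normsq_ext I v = (SUP F\<in>{F. finite F \<and> F \<subseteq> I}. ennreal (\<Sum>i\<in>F. (cmod (v i))\<^sup>2))"
  unfolding ell2_normsq_ext_def by (subst nonneg_infsum_complete) (auto simp: sum_nonneg)

lemma ell2_normsq_ext_le:
  assumes "\<And>F. finite F \<Longrightarrow> F \<subseteq> I \<Longrightarrow> ennreal (\<Sum>i\<in>F. (cmod (v i))\<^sup>2) \<le> b"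
  shows "ell2_normsq_ext I v \<le> b"
  unfolding ell2_normsq_ext_eq_SUP using assms by (intro SUP_least) auto

lemma sum_le_ell2_normsq_ext:
  "finite F \<Longrightarrow> F \<subseteq> I \<Longrightarrow> ennreal (\<Sum>i\<in>F. (cmod (v i))\<^sup>2) \<le> ell2_normsq_ext I v"
  unfolding ell2_normsq_ext_eq_SUP by (intro SUP_upper) auto

lemma ell2_normsq_ext_ell2:
  assumes "v \<in> ell2 I" shows "ell2_normsq_ext I v = ennreal ((ell2_norm I v)\<^sup>2)"
proof -
  have s: "(\<lambda>i. (cmod (v i))\<^sup>2) summable_on I" using assms by (simp add: ell2_def)
  have "ennreal (\<Sum>\<^sub>\<infinity>i\<in>I. (cmod (v i))\<^sup>2) = ell2_normsq_ext I v"
    unfolding ell2_normsq_ext_eq_SUP by (rule infsum_nonneg_is_SUPREMUM_ennreal[OF s]) simp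
  then show ?thesis by (simp add: ell2_norm_def infsum_nonneg)
qed

lemma ell2_iff: "v \<in> ell2 I \<longleftrightarrow> ell2_normsq_ext I v < \<infinity>"
proof
  assume "v \<in> ell2 I" then show "ell2_normsq_ext I v < \<infinity>" by (simp add: ell2_normsq_ext_ell2)
next
  assume fin: "ell2_normsq_ext I v < \<infinity>"
  then obtain r where r: "r \<ge> 0" "ell2_normsq_ext I v = ennreal r" by (cases "ell2_normsq_ext I v") auto
  have "(\<Sum>i\<in>F. (cmod (v i))\<^sup>2) \<le> r" if "finite F" "F \<subseteq> I" for F
    using sum_le_ell2_normsq_ext[OF that, of v] r by simp
  then show "v \<in> ell2 I" unfolding ell2_def
    by (auto intro!: nonneg_bdd_above_summable_on bdd_aboveI2)
qed

text \<open>For complex terms, summability and integrability against counting measure are both absolute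
  summability, and both sides are \<open>0\<close> when it fails. Hence the equation holds without a side condition, and
  row sums of the matrix are measurable in \<open>x\<close> even before they are known to converge.\<close>

lemma infsum_complex_eq_lebesgue_integral:
  fixes f :: "'i \<Rightarrow> complex"
  shows "infsum f A = (LINT i|count_space A. f i)"
proof (cases "integrable (count_space A) f")
  case True
  then show ?thesis using infsetsum_infsum[of f A] by (simp add: infsetsum_def Infinite_Set_Sum.abs_summable_on_def)
next
  case False
  then have "\<not> f summable_on A"
    using abs_summable_equivalent[of f A] summable_on_iff_abs_summable_on_complex[of f A]
    by (simp add: Infinite_Set_Sum.abs_summable_on_def)
  with False show ?thesis by (simp add: infsum_not_exists not_integrable_integral_eq)
qed

lemma L2_norm_eq_nn_integral:
  assumes "h \<in> L2" shows "ennreal ((L2_norm h)\<^sup>2) = (\<integral>\<^sup>+x. ennreal ((cmod (h x))\<^sup>2) \<partial>lebesgue)"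
  using assms unfolding L2_norm_def L2_def by (subst nn_integral_eq_integral) (auto simp: integral_nonneg_AE)

section \<open>Trigonometric polynomials\<close>

text \<open>The exponentials with period \<open>1/\<beta>\<close>.\<close>

definition fexp :: "real \<Rightarrow> int \<Rightarrow> real \<Rightarrow> complex" where
  "fexp \<beta> k x = cis (2 * pi * (\<beta> * of_int k) * x)"

abbreviation cell :: "real \<Rightarrow> real measure" where
  "cell \<beta> \<equiv> lebesgue_on {0..<1/\<beta>}"

definition trig_poly :: "real \<Rightarrow> (real \<Rightarrow> complex) \<Rightarrow> bool" where
  "trig_poly \<beta> p \<longleftrightarrow> (\<exists>F a. finite F \<and> p = (\<lambda>x. \<Sum>k\<in>F. a k * fexp \<beta> k x))"

lemma norm_fexp [simp]: "norm (fexp \<beta> k x) = 1"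
  by (simp add: fexp_def)

lemma fexp_mult: "fexp \<beta> j x * fexp \<beta> k x = fexp \<beta> (j + k) x"
  by (simp add: fexp_def cis_mult algebra_simps)

lemma cnj_fexp: "cnj (fexp \<beta> k x) = fexp \<beta> (- k) x"
  by (simp add: fexp_def cis_cnj)

lemma fexp_0 [simp]: "fexp \<beta> 0 x = 1"
  by (simp add: fexp_def)

lemma continuous_on_fexp [continuous_intros]: "continuous_on S (fexp \<beta> k)"
  unfolding fexp_def cis_conv_exp by (intro continuous_intros)

lemma fexp_measurable [measurable]: "fexp \<beta> k \<in> borel_measurable borel"
  by (intro borel_measurable_continuous_onI continuous_on_fexp)

lemma fexp_measurable_on [measurable]: "fexp \<beta> k \<in> borel_measurable (lebesgue_on S)"
  by (intro measurable_restrict_space1 measurable_completion) simp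

lemma finite_measure_cell: "finite_measure (cell \<beta>)"
  by (intro finite_measure_lebesgue_on bounded_set_imp_lmeasurable) auto

lemma integral_fexp:
  assumes "\<beta> > 0"
  shows "(LINT x|cell \<beta>. fexp \<beta> k x) = (if k = 0 then of_real (1 / \<beta>) else 0)"
proof (cases "k = 0")
  case True
  then show ?thesis using assms
    by (simp add: measure_restrict_space scaleR_conv_of_real)
next
  case False
  let ?c = "2 * pi * (\<beta> * of_int k)"
  have c: "?c \<noteq> 0" using assms False by simp
  define F where "F x = fexp \<beta> k x / (\<i> * of_real ?c)" for x
  have "(fexp \<beta> k has_integral (F (1/\<beta>) - F 0)) {0..1/\<beta>}"
  proof (rule fundamental_theorem_of_calculus)
    fix x
    have "((\<lambda>x. exp (\<i> * of_real ?c * of_real x)) has_vector_derivative (\<i> * of_real ?c * exp (\<i> * of_real ?c * of_real x))) (at x within {0..1/\<beta>})"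
      by (rule has_vector_derivative_real_field) (auto intro!: derivative_eq_intros)
    then have "((\<lambda>x. cis (?c * x)) has_vector_derivative (\<i> * of_real ?c * cis (?c * x))) (at x within {0..1/\<beta>})"
      by (simp add: cis_conv_exp mult.assoc)
    then have "((\<lambda>x. cis (?c * x) / (\<i> * of_real ?c)) has_vector_derivative
       (\<i> * of_real ?c * cis (?c * x)) / (\<i> * of_real ?c)) (at x within {0..1/\<beta>})"
      by (intro has_vector_derivative_divide)
    then show "(F has_vector_derivative fexp \<beta> k x) (at x within {0..1/\<beta>})"
      using c unfolding F_def fexp_def by simp
  qed (use assms in simp)
  moreover have "F (1/\<beta>) = F 0"
    using assms cis_multiple_2pi[of "of_int k"] by (simp add: F_def fexp_def mult.assoc)
  ultimately have "(fexp \<beta> k has_integral 0) {0..1/\<beta>}" by simp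
  then have "(fexp \<beta> k has_integral 0) {0..<1/\<beta>}"
    by (subst has_integral_spike_set_eq[where T = "{0..1/\<beta>}"])
       (auto intro: negligible_subset[of "{1/\<beta>}"])
  moreover have "integrable (cell \<beta>) (fexp \<beta> k)"
    by (intro finite_measure.integrable_const_bound[OF finite_measure_cell, of _ 1]) auto
  ultimately show ?thesis using False
    by (simp add: lebesgue_integral_eq_integral integral_unique)
qed

lemma fexp_orthogonal:
  assumes "\<beta> > 0"
  shows "(LINT x|cell \<beta>. fexp \<beta> j x * cnj (fexp \<beta> k x)) = (if j = k then of_real (1 / \<beta>) else 0)"
  using integral_fexp[OF assms, of "j - k"] by (simp add: cnj_fexp fexp_mult)

lemma trig_poly_add: 
  assumes "trig_poly \<beta> p" "trig_poly \<beta> q" shows "trig_poly \<beta> (\<lambda>x. p x + q x)"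
proof -
  obtain F a G b where 1: "finite F" "p = (\<lambda>x. \<Sum>k\<in>F. a k * fexp \<beta> k x)"
     "finite G" "q = (\<lambda>x. \<Sum>k\<in>G. b k * fexp \<beta> k x)"
    using assms unfolding trig_poly_def by blast
  have "p x + q x = (\<Sum>k\<in>F \<union> G. ((if k \<in> F then a k else 0) + (if k \<in> G then b k else 0)) * fexp \<beta> k x)" for x
  proof -
    have "p x = (\<Sum>k\<in>F \<union> G. (if k \<in> F then a k else 0) * fexp \<beta> k x)"
      unfolding 1 by (rule sum.mono_neutral_cong_left) (use 1 in auto)
    moreover have "q x = (\<Sum>k\<in>F \<union> G. (if k \<in> G then b k else 0) * fexp \<beta> k x)"
      unfolding 1 by (rule sum.mono_neutral_cong_left) (use 1 in auto)
    ultimately show ?thesis by (simp add: sum.distrib ring_distribs)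
  qed
  then show ?thesis unfolding trig_poly_def using 1 
    by (intro exI[of _ "F \<union> G"] exI[of _ "\<lambda>k. (if k \<in> F then a k else 0) + (if k \<in> G then b k else 0)"]) auto
qed

lemma trig_poly_sum:
  assumes "finite I" "\<And>i. i \<in> I \<Longrightarrow> trig_poly \<beta> (p i)"
  shows "trig_poly \<beta> (\<lambda>x. \<Sum>i\<in>I. p i x)"
  using assms
proof (induction I rule: finite_induct)
  case empty
  show ?case unfolding trig_poly_def by (intro exI[of _ "{}"]) auto
qed (auto intro: trig_poly_add)

lemma trig_poly_monomial: "trig_poly \<beta> (\<lambda>x. a * fexp \<beta> k x)"
  unfolding trig_poly_def by (intro exI[of _ "{k}"] exI[of _ "\<lambda>_. a"]) auto

lemma trig_poly_mult:
  assumes "trig_poly \<beta> p" "trig_poly \<beta> q" shows "trig_poly \<beta> (\<lambda>x. p x * q x)"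
proof -
  obtain F a G b where 1: "finite F" "p = (\<lambda>x. \<Sum>k\<in>F. a k * fexp \<beta> k x)"
     "finite G" "q = (\<lambda>x. \<Sum>k\<in>G. b k * fexp \<beta> k x)"
    using assms unfolding trig_poly_def by blast
  have "p x * q x = (\<Sum>k\<in>F. \<Sum>l\<in>G. (a k * b l) * fexp \<beta> (k + l) x)" for x
    unfolding 1 sum_product by (intro sum.cong) (simp_all add: flip: fexp_mult)
  then show ?thesis using 1 by (simp add: trig_poly_sum trig_poly_monomial)
qed

lemma trig_poly_const: "trig_poly \<beta> (\<lambda>x. a)"
  using trig_poly_monomial[of \<beta> a 0] by simp

text \<open>On the unit circle \<open>Re z\<close> and \<open>Im z\<close> are linear combinations of \<open>z\<close> and \<open>1/z\<close>, so every real
  polynomial in them is a trigonometric polynomial.\<close>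

lemma trig_poly_real_polynomial:
  assumes "real_polynomial_function (p :: complex \<Rightarrow> real)"
  shows "trig_poly \<beta> (\<lambda>x. of_real (p (fexp \<beta> 1 x)))"
  using assms
proof induction
  case (linear f)
  have "f z = Re z * f 1 + Im z * f \<i>" for z
  proof -
    interpret bounded_linear f by fact
    have "f (Re z *\<^sub>R 1 + Im z *\<^sub>R \<i>) = Re z * f 1 + Im z * f \<i>"
      by (simp only: add scaleR real_scaleR_def)
    then show ?thesis by (simp add: scaleR_conv_of_real mult.commute flip: complex_eq)
  qed
  moreover have "of_real (Re z * f 1 + Im z * f \<i>) =
      (of_real (f 1) / 2 - \<i> * of_real (f \<i>) / 2) * z + (of_real (f 1) / 2 + \<i> * of_real (f \<i>) / 2) * cnj z" for z
    by (simp add: complex_eq_iff)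
  ultimately have "of_real (f (fexp \<beta> 1 x)) =
      (of_real (f 1) / 2 - \<i> * of_real (f \<i>) / 2) * fexp \<beta> 1 x +
      (of_real (f 1) / 2 + \<i> * of_real (f \<i>) / 2) * fexp \<beta> (- 1) x" for x
    by (metis cnj_fexp)
  then show ?case
    by (simp add: trig_poly_add trig_poly_monomial)
next
  case (const c) then show ?case by (simp add: trig_poly_const)
next
  case (add f g) then show ?case by (simp add: trig_poly_add)
next
  case (mult f g) then show ?case by (simp add: trig_poly_mult)
qed

lemma trig_poly_polynomial:
  assumes "polynomial_function (p :: complex \<Rightarrow> complex)"
  shows "trig_poly \<beta> (\<lambda>x. p (fexp \<beta> 1 x))"
proof -
  have "real_polynomial_function (Re \<circ> p)" "real_polynomial_function (Im \<circ> p)"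
    using assms bounded_linear_Re bounded_linear_Im unfolding polynomial_function_def by blast+
  from this[THEN trig_poly_real_polynomial, of \<beta>]
  have "trig_poly \<beta> (\<lambda>x. of_real (Re (p (fexp \<beta> 1 x))) + \<i> * of_real (Im (p (fexp \<beta> 1 x))))"
    by (intro trig_poly_add trig_poly_mult trig_poly_const) (auto simp: o_def)
  then show ?thesis by (simp flip: complex_eq)
qed

text \<open>A loop on \<open>[0,1]\<close> factors continuously through the circle. This is read off from the statement that
  homotopic loops give homotopic circle maps, applied to the constant homotopy.\<close>

lemma continuous_on_circle_Arg2pi:
  fixes f :: "real \<Rightarrow> complex"
  assumes f: "continuous_on {0..1} f" and f01: "f 0 = f 1"
  shows "continuous_on (sphere 0 1) (\<lambda>z. f (Arg2pi z / (2*pi)))"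
proof -
  have "homotopic_loops UNIV f f"
    using assms by (simp add: homotopic_loops_refl path_def pathstart_def pathfinish_def)
  from homotopic_with_imp_continuous[OF homotopic_loops_imp_homotopic_circlemaps[OF this]]
  show ?thesis by (simp add: o_def)
qed

text \<open>The Stone-Weierstrass theorem on the unit circle, transported to one period.\<close>

lemma trig_poly_uniform_approx:
  fixes f :: "real \<Rightarrow> complex"
  assumes "\<beta> > 0" and f: "continuous_on {0..1/\<beta>} f" "f 0 = f (1/\<beta>)" and "e > 0"
  obtains p where "trig_poly \<beta> p" "\<And>x. x \<in> {0..<1/\<beta>} \<Longrightarrow> norm (f x - p x) < e"
proof -
  define F where "F z = f (Arg2pi z / (2*pi) / \<beta>)" for z
  have "continuous_on {0..1} (\<lambda>t. f (t / \<beta>))"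
    by (intro continuous_on_compose2[OF f(1)] continuous_intros) (use assms in \<open>auto simp: field_simps\<close>)
  then have "continuous_on (sphere 0 1) F"
    unfolding F_def by (rule continuous_on_circle_Arg2pi) (use f in simp)
  from Stone_Weierstrass_polynomial_function[OF _ this \<open>e > 0\<close>]
  obtain q where q: "polynomial_function q" "\<And>z. z \<in> sphere 0 1 \<Longrightarrow> norm (F z - q z) < e"
    by auto
  show thesis
  proof (rule that[OF trig_poly_polynomial[OF q(1)]])
    fix x assume x: "x \<in> {0..<1/\<beta>}"
    have "Arg2pi (fexp \<beta> 1 x) = 2 * pi * \<beta> * x"
    proof (rule Arg2pi_unique[of 1])
      show "complex_of_real 1 * exp (\<i> * complex_of_real (2 * pi * \<beta> * x)) = fexp \<beta> 1 x"
        by (simp add: fexp_def cis_conv_exp)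
    qed (use x assms in \<open>auto simp: field_simps\<close>)
    then have "F (fexp \<beta> 1 x) = f x" using assms by (simp add: F_def)
    then show "norm (f x - q (fexp \<beta> 1 x)) < e" using q(2)[of "fexp \<beta> 1 x"] by simp
  qed
qed

section \<open>Parseval's identity on one period\<close>

lemma borel_measurable_cnj [measurable]:
  "f \<in> borel_measurable M \<Longrightarrow> (\<lambda>x. cnj (f x)) \<in> borel_measurable M"
  by (simp add: borel_measurable_complex_iff)

lemma integrable_mult_L2:
  fixes f g :: "'a \<Rightarrow> complex"
  assumes [measurable]: "f \<in> borel_measurable M" "g \<in> borel_measurable M"
    and "integrable M (\<lambda>x. (cmod (f x))\<^sup>2)" "integrable M (\<lambda>x. (cmod (g x))\<^sup>2)"
  shows "integrable M (\<lambda>x. f x * g x)"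
proof (rule Bochner_Integration.integrable_bound)
  show "integrable M (\<lambda>x. (cmod (f x))\<^sup>2 + (cmod (g x))\<^sup>2)" using assms by simp
  have "a * b \<le> a\<^sup>2 + b\<^sup>2" if "a \<ge> 0" "b \<ge> 0" for a b :: real
    using that sum_squares_bound[of a b] mult_nonneg_nonneg[OF that] by linarith
  then show "AE x in M. cmod (f x * g x) \<le> norm ((cmod (f x))\<^sup>2 + (cmod (g x))\<^sup>2)"
    by (simp add: norm_mult)
qed simp

lemma trig_poly_measurable:
  assumes "trig_poly \<beta> p" shows "p \<in> borel_measurable (cell \<beta>)"
  using assms unfolding trig_poly_def by (auto intro!: borel_measurable_sum borel_measurable_times)

lemma trig_poly_bounded:
  assumes "trig_poly \<beta> p" obtains C where "\<And>x. cmod (p x) \<le> C"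
proof -
  obtain F a where p: "finite F" "p = (\<lambda>x. \<Sum>k\<in>F. a k * fexp \<beta> k x)"
    using assms unfolding trig_poly_def by blast
  have "cmod (p x) \<le> (\<Sum>k\<in>F. cmod (a k))" for x
    unfolding p by (rule order_trans[OF norm_sum]) (simp add: norm_mult)
  then show thesis by (rule that)
qed

lemma trig_poly_square_integrable:
  assumes "trig_poly \<beta> p" shows "integrable (cell \<beta>) (\<lambda>x. (cmod (p x))\<^sup>2)"
proof -
  obtain C where C: "\<And>x. cmod (p x) \<le> C" using trig_poly_bounded[OF assms] by blast
  note trig_poly_measurable[OF assms, measurable]
  show ?thesis
    by (intro finite_measure.integrable_const_bound[OF finite_measure_cell, of _ "C\<^sup>2"])
       (use C in \<open>auto intro!: AE_I2 power_mono\<close>)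
qed

text \<open>Completing the square in the coefficients: the distance from \<open>f\<close> to a trigonometric polynomial splits
  into the defect in Bessel's inequality and a nonnegative term that vanishes for the Fourier coefficients. So
  the choice \<open>a k = \<beta> * c k\<close> gives Bessel's inequality, and any good approximation of \<open>f\<close> shows that the defect
  is small.\<close>

lemma integral_dist_trig_poly:
  assumes "\<beta> > 0" and f: "f \<in> borel_measurable (cell \<beta>)" "integrable (cell \<beta>) (\<lambda>x. (cmod (f x))\<^sup>2)"
    and F: "finite F"
  defines "c \<equiv> (\<lambda>k. LINT x|cell \<beta>. f x * cnj (fexp \<beta> k x))"
  shows "(LINT x|cell \<beta>. (cmod (f x - (\<Sum>k\<in>F. a k * fexp \<beta> k x)))\<^sup>2) =
    (LINT x|cell \<beta>. (cmod (f x))\<^sup>2) - \<beta> * (\<Sum>k\<in>F. (cmod (c k))\<^sup>2) +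
    (\<Sum>k\<in>F. (cmod (a k - \<beta> * c k))\<^sup>2) / \<beta>"
proof -
  define p where "p = (\<lambda>x. \<Sum>k\<in>F. a k * fexp \<beta> k x)"
  have tp: "trig_poly \<beta> p" unfolding p_def trig_poly_def using F by blast
  note p = trig_poly_measurable[OF tp] trig_poly_square_integrable[OF tp]
  have e: "fexp \<beta> k \<in> borel_measurable (cell \<beta>)" "integrable (cell \<beta>) (\<lambda>x. (cmod (fexp \<beta> k x))\<^sup>2)" for k
    using trig_poly_square_integrable[OF trig_poly_monomial[of \<beta> 1 k]] by simp_all
  have int: "integrable (cell \<beta>) (\<lambda>x. u x * cnj (v x))"
    if "u \<in> borel_measurable (cell \<beta>)" "integrable (cell \<beta>) (\<lambda>x. (cmod (u x))\<^sup>2)"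
       "v \<in> borel_measurable (cell \<beta>)" "integrable (cell \<beta>) (\<lambda>x. (cmod (v x))\<^sup>2)" for u v
    using that by (intro integrable_mult_L2) auto
  have ip: "(LINT x|cell \<beta>. u x * cnj (p x)) = (\<Sum>k\<in>F. cnj (a k) * (LINT x|cell \<beta>. u x * cnj (fexp \<beta> k x)))"
    if u: "u \<in> borel_measurable (cell \<beta>)" "integrable (cell \<beta>) (\<lambda>x. (cmod (u x))\<^sup>2)" for u
  proof -
    have "u x * cnj (p x) = (\<Sum>k\<in>F. cnj (a k) * (u x * cnj (fexp \<beta> k x)))" for x
      by (simp add: p_def sum_distrib_left mult_ac)
    then show ?thesis using int[OF u e] by (simp add: Bochner_Integration.integral_sum)
  qed
  have pe: "(LINT x|cell \<beta>. p x * cnj (fexp \<beta> k x)) = a k / \<beta>" if "k \<in> F" for k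
  proof -
    have "p x * cnj (fexp \<beta> k x) = (\<Sum>j\<in>F. a j * (fexp \<beta> j x * cnj (fexp \<beta> k x)))" for x
      by (simp add: p_def sum_distrib_left sum_distrib_right mult_ac)
    then have "(LINT x|cell \<beta>. p x * cnj (fexp \<beta> k x)) = (\<Sum>j\<in>F. a j * (LINT x|cell \<beta>. fexp \<beta> j x * cnj (fexp \<beta> k x)))"
      using int[OF e e] by (simp add: Bochner_Integration.integral_sum)
    also have "\<dots> = (\<Sum>j\<in>F. if j = k then a k / \<beta> else 0)"
      by (intro sum.cong) (simp_all add: fexp_orthogonal[OF \<open>\<beta> > 0\<close>])
    finally show ?thesis using F that by simp
  qed
  have fp: "(LINT x|cell \<beta>. f x * cnj (p x)) = (\<Sum>k\<in>F. cnj (a k) * c k)"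
    using ip[OF f] by (simp add: c_def)
  have pp: "(LINT x|cell \<beta>. p x * cnj (p x)) = (\<Sum>k\<in>F. of_real ((cmod (a k))\<^sup>2 / \<beta>))"
    unfolding ip[OF p] by (intro sum.cong) (simp_all add: pe complex_norm_square[unfolded of_real_power] mult.commute)
  have pt: "(cmod (f x - p x))\<^sup>2 = (cmod (f x))\<^sup>2 - 2 * Re (f x * cnj (p x)) + Re (p x * cnj (p x))" for x
    unfolding cmod_power2 by (simp add: power2_eq_square algebra_simps)
  have "(LINT x|cell \<beta>. (cmod (f x - p x))\<^sup>2) =
     (LINT x|cell \<beta>. (cmod (f x))\<^sup>2) - 2 * Re (LINT x|cell \<beta>. f x * cnj (p x)) + Re (LINT x|cell \<beta>. p x * cnj (p x))"
  proof -
    define u v where "u = (\<lambda>x. Re (f x * cnj (p x)))" and "v = (\<lambda>x. Re (p x * cnj (p x)))"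
    have u: "integrable (cell \<beta>) u" "(LINT x|cell \<beta>. u x) = Re (LINT x|cell \<beta>. f x * cnj (p x))"
      using int[OF f p] unfolding u_def by (rule integrable_Re, rule integral_Re)
    have v: "integrable (cell \<beta>) v" "(LINT x|cell \<beta>. v x) = Re (LINT x|cell \<beta>. p x * cnj (p x))"
      using int[OF p p] unfolding v_def by (rule integrable_Re, rule integral_Re)
    have "(cmod (f x - p x))\<^sup>2 = (cmod (f x))\<^sup>2 - 2 * u x + v x" for x
      unfolding u_def v_def by (rule pt)
    then show ?thesis using u v f(2) by simp
  qed
  also have "\<dots> = (LINT x|cell \<beta>. (cmod (f x))\<^sup>2) + (\<Sum>k\<in>F. - 2 * Re (cnj (a k) * c k) + (cmod (a k))\<^sup>2 / \<beta>)"
    unfolding fp pp Re_sum by (simp add: sum.distrib sum_distrib_left sum_negf sum_subtractf)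
  also have "(\<Sum>k\<in>F. - 2 * Re (cnj (a k) * c k) + (cmod (a k))\<^sup>2 / \<beta>) =
    (\<Sum>k\<in>F. - \<beta> * (cmod (c k))\<^sup>2 + (cmod (a k - \<beta> * c k))\<^sup>2 / \<beta>)"
    using \<open>\<beta> > 0\<close> by (intro sum.cong refl) (simp add: cmod_power2, simp add: power2_eq_square field_simps)
  also have "\<dots> = - \<beta> * (\<Sum>k\<in>F. (cmod (c k))\<^sup>2) + (\<Sum>k\<in>F. (cmod (a k - \<beta> * c k))\<^sup>2) / \<beta>"
    by (simp add: sum.distrib sum_distrib_left sum_divide_distrib sum_negf sum_subtractf)
  finally show ?thesis unfolding p_def by simp
qed

definition L2_approximable :: "real \<Rightarrow> (real \<Rightarrow> complex) \<Rightarrow> bool" where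
  "L2_approximable \<beta> f \<longleftrightarrow> (\<forall>e>0. \<exists>p. trig_poly \<beta> p \<and> (\<integral>\<^sup>+x. ennreal ((cmod (f x - p x))\<^sup>2) \<partial>cell \<beta>) < e)"

lemma cmod_diff_square_le: 
  "ennreal ((cmod (a - c))\<^sup>2) \<le> 2 * ennreal ((cmod (a - b))\<^sup>2) + 2 * ennreal ((cmod (b - c))\<^sup>2)"
proof -
  have "cmod (a - c) \<le> cmod (a - b) + cmod (b - c)" using norm_triangle_ineq[of "a - b" "b - c"] by simp
  then have "(cmod (a - c))\<^sup>2 \<le> (cmod (a - b) + cmod (b - c))\<^sup>2" by (rule power_mono) simp
  also have "\<dots> \<le> 2 * (cmod (a - b))\<^sup>2 + 2 * (cmod (b - c))\<^sup>2"
    using sum_squares_bound[of "cmod (a - b)" "cmod (b - c)"] by (simp add: power2_sum)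
  finally have "ennreal ((cmod (a - c))\<^sup>2) \<le> ennreal (2 * (cmod (a - b))\<^sup>2 + 2 * (cmod (b - c))\<^sup>2)"
    by (rule ennreal_leI)
  then show ?thesis by (simp add: ennreal_plus ennreal_mult)
qed

text \<open>The functions that trigonometric polynomials approximate in \<open>L\<^sup>2\<close> are closed under dominated pointwise
  limits. This lets the class grow from continuous to bounded measurable to square integrable functions.\<close>

lemma L2_approximable_limit:
  assumes f [measurable]: "f \<in> borel_measurable (cell \<beta>)"
    and g [measurable]: "\<And>n. g n \<in> borel_measurable (cell \<beta>)"
    and ap: "\<And>n. L2_approximable \<beta> (g n)"
    and lim: "AE x in cell \<beta>. (\<lambda>n. g n x) \<longlonglongrightarrow> f x"
    and dom: "\<And>n. AE x in cell \<beta>. ennreal ((cmod (f x - g n x))\<^sup>2) \<le> w x"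
    and w [measurable]: "w \<in> borel_measurable (cell \<beta>)" and wfin: "(\<integral>\<^sup>+x. w x \<partial>cell \<beta>) < \<infinity>"
  shows "L2_approximable \<beta> f"
  unfolding L2_approximable_def
proof (intro allI impI)
  fix e :: ennreal assume e: "e > 0"
  define d where "d = min (e / 4) 1"
  have d: "d > 0" "2 * d + 2 * d \<le> e" "d < \<infinity>" 
  proof -
    show "d > 0" using e by (auto simp: d_def ennreal_zero_less_divide)
    have "2 * d + 2 * d = 4 * d" by (simp flip: distrib_right)
    also have "\<dots> \<le> 4 * (e / 4)" unfolding d_def by (intro mult_left_mono) auto
    also have "\<dots> = e" by (simp add: ennreal_times_divide mult.commute[of 4] ennreal_mult_divide_eq)
    finally show "2 * d + 2 * d \<le> e" .
    show "d < \<infinity>" unfolding d_def by (metis min_less_iff_disj ennreal_one_less_top infinity_ennreal_def)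
  qed
  have "(\<lambda>n. \<integral>\<^sup>+x. ennreal ((cmod (f x - g n x))\<^sup>2) \<partial>cell \<beta>) \<longlonglongrightarrow> (\<integral>\<^sup>+x. 0 \<partial>cell \<beta>)"
  proof (rule nn_integral_dominated_convergence[where w = w])
    show "AE x in cell \<beta>. (\<lambda>n. ennreal ((cmod (f x - g n x))\<^sup>2)) \<longlonglongrightarrow> 0"
      using lim
    proof eventually_elim
      case (elim x)
      have "(\<lambda>n. (cmod (f x - g n x))\<^sup>2) \<longlonglongrightarrow> (cmod (f x - f x))\<^sup>2"
        by (intro tendsto_intros elim)
      then have "(\<lambda>n. ennreal ((cmod (f x - g n x))\<^sup>2)) \<longlonglongrightarrow> ennreal 0"
        by (intro tendsto_ennrealI) simp
      then show ?case by simp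
    qed
  qed (use dom wfin in auto)
  then have "eventually (\<lambda>n. (\<integral>\<^sup>+x. ennreal ((cmod (f x - g n x))\<^sup>2) \<partial>cell \<beta>) < d) sequentially"
    using d by (auto dest!: order_tendstoD(2))
  then obtain n where n: "(\<integral>\<^sup>+x. ennreal ((cmod (f x - g n x))\<^sup>2) \<partial>cell \<beta>) < d"
    by (auto simp: eventually_sequentially)
  obtain p where p: "trig_poly \<beta> p" "(\<integral>\<^sup>+x. ennreal ((cmod (g n x - p x))\<^sup>2) \<partial>cell \<beta>) < d"
    using ap[of n] d unfolding L2_approximable_def by blast
  note [measurable] = trig_poly_measurable[OF p(1)]
  have "(\<integral>\<^sup>+x. ennreal ((cmod (f x - p x))\<^sup>2) \<partial>cell \<beta>) \<le>
     (\<integral>\<^sup>+x. 2 * ennreal ((cmod (f x - g n x))\<^sup>2) + 2 * ennreal ((cmod (g n x - p x))\<^sup>2) \<partial>cell \<beta>)"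
    by (intro nn_integral_mono cmod_diff_square_le)
  also have "\<dots> = 2 * (\<integral>\<^sup>+x. ennreal ((cmod (f x - g n x))\<^sup>2) \<partial>cell \<beta>) + 2 * (\<integral>\<^sup>+x. ennreal ((cmod (g n x - p x))\<^sup>2) \<partial>cell \<beta>)"
    by (simp add: nn_integral_add nn_integral_cmult)
  also have "\<dots> < 2 * d + 2 * d"
    using n p(2) by (intro add_strict_mono ennreal_mult_strict_left_mono) auto
  also have "\<dots> \<le> e" by (rule d)
  finally show "\<exists>p. trig_poly \<beta> p \<and> (\<integral>\<^sup>+x. ennreal ((cmod (f x - p x))\<^sup>2) \<partial>cell \<beta>) < e"
    using p(1) by blast
qed

lemma L2_approximable_continuous:
  assumes "\<beta> > 0" "continuous_on {0..1/\<beta>} f" "f 0 = f (1/\<beta>)"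
  shows "L2_approximable \<beta> f"
  unfolding L2_approximable_def
proof (intro allI impI)
  fix e :: ennreal assume e: "e > 0"
  obtain r :: real where r: "r > 0" "ennreal r < e"
    using ennreal_rat_dense[OF e] by (metis ennreal_less_zero_iff)
  define d where "d = sqrt (r * \<beta>)"
  have d: "d > 0" "d\<^sup>2 / \<beta> = r" using r assms by (simp_all add: d_def)
  obtain p where p: "trig_poly \<beta> p" "\<And>x. x \<in> {0..<1/\<beta>} \<Longrightarrow> cmod (f x - p x) < d"
    using trig_poly_uniform_approx[OF assms d(1)] by blast
  have "(\<integral>\<^sup>+x. ennreal ((cmod (f x - p x))\<^sup>2) \<partial>cell \<beta>) \<le> (\<integral>\<^sup>+x. ennreal (d\<^sup>2) \<partial>cell \<beta>)"
    by (intro nn_integral_mono ennreal_leI power_mono) (use p(2) in \<open>auto simp: space_restrict_space less_imp_le\<close>)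
  also have "\<dots> = ennreal (d\<^sup>2) * ennreal (1/\<beta>)"
    using assms by (simp add: emeasure_restrict_space space_restrict_space)
  also have "\<dots> = ennreal r" using d assms by (simp flip: ennreal_mult)
  finally show "\<exists>p. trig_poly \<beta> p \<and> (\<integral>\<^sup>+x. ennreal ((cmod (f x - p x))\<^sup>2) \<partial>cell \<beta>) < e"
    using p(1) r(2) by (meson le_less_trans)
qed

text \<open>The radial retraction of the plane onto the disc of radius \<open>C\<close>, in a form that is visibly continuous.\<close>

definition clamp_norm :: "real \<Rightarrow> complex \<Rightarrow> complex" where
  "clamp_norm C z = of_real (C / max C (cmod z)) * z"

lemma norm_clamp_norm: "C > 0 \<Longrightarrow> cmod (clamp_norm C z) \<le> C"
  by (simp add: clamp_norm_def norm_mult norm_divide field_simps max_def)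

lemma clamp_norm_id: "C > 0 \<Longrightarrow> cmod z \<le> C \<Longrightarrow> clamp_norm C z = z"
  by (simp add: clamp_norm_def max_def)

lemma norm_diff_clamp_norm: "C > 0 \<Longrightarrow> cmod (z - clamp_norm C z) \<le> cmod z"
proof -
  assume C: "C > 0"
  have "z - clamp_norm C z = of_real (1 - C / max C (cmod z)) * z" by (simp add: clamp_norm_def algebra_simps)
  then have "cmod (z - clamp_norm C z) = \<bar>1 - C / max C (cmod z)\<bar> * cmod z" by (simp only: norm_mult norm_of_real)
  also have "\<dots> \<le> 1 * cmod z" using C by (intro mult_right_mono) (auto simp: abs_le_iff divide_le_eq max_def)
  finally show ?thesis by simp
qed

lemma continuous_on_clamp_norm: "C > 0 \<Longrightarrow> continuous_on S (clamp_norm C)"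
  unfolding clamp_norm_def by (intro continuous_intros) (auto simp: max_def)

text \<open>A measurable function is an almost everywhere limit of continuous functions. Clamping them keeps them
  uniformly bounded, and a cutoff makes them vanish at both ends of the period, so that they are periodic.\<close>

lemma L2_approximable_bounded:
  assumes "\<beta> > 0" and f: "f \<in> borel_measurable (cell \<beta>)" and "C > 0" "\<And>x. cmod (f x) \<le> C"
  shows "L2_approximable \<beta> f"
proof -
  have "f measurable_on {0..<1/\<beta>}" using f by (simp add: measurable_on_iff_borel_measurable)
  then obtain N g where N: "negligible N" and g: "\<And>n. continuous_on UNIV (g n)"
     and lim: "\<And>x. x \<notin> N \<Longrightarrow> (\<lambda>n. g n x) \<longlonglongrightarrow> (if x \<in> {0..<1/\<beta>} then f x else 0)"
    unfolding measurable_on_def by blast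
  \<comment> \<open>the cutoff: \<open>0\<close> at both ends of the period, eventually \<open>1\<close> at every interior point\<close>
  define \<phi> :: "nat \<Rightarrow> real \<Rightarrow> real" where "\<phi> n x = min 1 (real n * min x (1/\<beta> - x))" for n x
  define h where "h n x = of_real (\<phi> n x) * clamp_norm C (g n x)" for n x
  have h: "continuous_on S (h n)" for n S
    unfolding h_def \<phi>_def
    by (intro continuous_intros continuous_on_compose2[OF continuous_on_clamp_norm[OF \<open>C > 0\<close>, of UNIV]]
        continuous_on_subset[OF g]) auto
  have \<phi>: "0 \<le> \<phi> n x \<and> \<phi> n x \<le> 1" if "x \<in> {0..<1/\<beta>}" for n x
    using that by (auto simp: \<phi>_def)
  show ?thesis
  proof (rule L2_approximable_limit[where g = h and w = "\<lambda>_. ennreal ((2 * C)\<^sup>2)", OF f])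
    show "h n \<in> borel_measurable (cell \<beta>)" for n
      by (intro measurable_restrict_space1 measurable_completion) (simp add: borel_measurable_continuous_onI h)
    show "L2_approximable \<beta> (h n)" for n
      by (rule L2_approximable_continuous[OF \<open>\<beta> > 0\<close> h]) (use \<open>\<beta> > 0\<close> in \<open>simp add: h_def \<phi>_def\<close>)
    have "AE x in lebesgue. x \<notin> N \<union> {0}"
      using negligible_Un[OF N negligible_sing] by (intro AE_not_in) (simp add: negligible_iff_null_sets)
    then have "AE x in cell \<beta>. x \<notin> N \<union> {0} \<and> x \<in> {0..<1/\<beta>}"
      by (subst AE_restrict_space_iff) auto
    then show "AE x in cell \<beta>. (\<lambda>n. h n x) \<longlonglongrightarrow> f x"
    proof eventually_elim
      case (elim x)
      define d where "d = min x (1/\<beta> - x)"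
      have "d > 0" using elim by (auto simp: d_def)
      obtain K where K: "1 / d \<le> real K" using real_arch_simple by blast
      have "eventually (\<lambda>n. \<phi> n x = 1) sequentially"
        using eventually_ge_at_top[of K]
      proof eventually_elim
        case (elim n)
        have "1 / d \<le> real n" using K elim by linarith
        then have "1 \<le> real n * d" using \<open>d > 0\<close> by (simp add: field_simps)
        then show ?case by (simp add: \<phi>_def d_def)
      qed
      then have "(\<lambda>n. \<phi> n x) \<longlonglongrightarrow> 1" by (rule tendsto_eventually)
      moreover have "(\<lambda>n. clamp_norm C (g n x)) \<longlonglongrightarrow> clamp_norm C (f x)"
        using continuous_on_clamp_norm[OF \<open>C > 0\<close>, of UNIV] lim[of x] elim
        by (intro isCont_tendsto_compose[of _ "clamp_norm C"]) (auto simp: continuous_on_eq_continuous_at)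
      ultimately have "(\<lambda>n. h n x) \<longlonglongrightarrow> of_real 1 * clamp_norm C (f x)"
        unfolding h_def by (intro tendsto_intros)
      then show ?case using clamp_norm_id[OF \<open>C > 0\<close> assms(4)] by simp
    qed
    show "AE x in cell \<beta>. ennreal ((cmod (f x - h n x))\<^sup>2) \<le> ennreal ((2 * C)\<^sup>2)" for n
    proof (rule AE_I2, intro ennreal_leI power_mono norm_ge_zero)
      fix x assume "x \<in> space (cell \<beta>)"
      then have x: "x \<in> {0..<1/\<beta>}" by (simp add: space_restrict_space)
      have "cmod (h n x) = \<phi> n x * cmod (clamp_norm C (g n x))" using \<phi>[OF x] by (simp add: h_def norm_mult)
      also have "\<dots> \<le> 1 * C" using \<phi>[OF x] by (intro mult_mono norm_clamp_norm) (use \<open>C > 0\<close> in auto)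
      finally show "cmod (f x - h n x) \<le> 2 * C"
        using assms(4)[of x] norm_triangle_ineq4[of "f x" "h n x"] by linarith
    qed
    show "(\<integral>\<^sup>+x. ennreal ((2 * C)\<^sup>2) \<partial>cell \<beta>) < \<infinity>"
      using \<open>\<beta> > 0\<close> by (simp add: emeasure_restrict_space space_restrict_space ennreal_mult_less_top)
  qed simp
qed

lemma L2_approximable_square_integrable:
  assumes "\<beta> > 0" and f [measurable]: "f \<in> borel_measurable (cell \<beta>)"
    and i: "integrable (cell \<beta>) (\<lambda>x. (cmod (f x))\<^sup>2)"
  shows "L2_approximable \<beta> f"
proof (rule L2_approximable_limit[where g = "\<lambda>n x. clamp_norm (real (Suc n)) (f x)" and w = "\<lambda>x. ennreal ((cmod (f x))\<^sup>2)", OF f])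
  have [measurable]: "clamp_norm (real (Suc n)) \<in> borel_measurable borel" for n
    by (intro borel_measurable_continuous_onI continuous_on_clamp_norm) simp
  show m: "(\<lambda>x. clamp_norm (real (Suc n)) (f x)) \<in> borel_measurable (cell \<beta>)" for n
    by measurable
  show "L2_approximable \<beta> (\<lambda>x. clamp_norm (real (Suc n)) (f x))" for n
    by (rule L2_approximable_bounded[where C = "real (Suc n)"]) (use assms(1) m norm_clamp_norm in auto)
  show "AE x in cell \<beta>. (\<lambda>n. clamp_norm (real (Suc n)) (f x)) \<longlonglongrightarrow> f x"
  proof (rule AE_I2)
    fix x
    obtain N where N: "cmod (f x) \<le> real N" using real_arch_simple by blast
    have "eventually (\<lambda>n. clamp_norm (real (Suc n)) (f x) = f x) sequentially"
      using eventually_ge_at_top[of N] by eventually_elim (use N in \<open>auto intro!: clamp_norm_id\<close>)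
    then show "(\<lambda>n. clamp_norm (real (Suc n)) (f x)) \<longlonglongrightarrow> f x" by (rule tendsto_eventually)
  qed
  show "AE x in cell \<beta>. ennreal ((cmod (f x - clamp_norm (real (Suc n)) (f x)))\<^sup>2) \<le> ennreal ((cmod (f x))\<^sup>2)" for n
    by (intro AE_I2 ennreal_leI power_mono norm_diff_clamp_norm) auto
  show "(\<integral>\<^sup>+x. ennreal ((cmod (f x))\<^sup>2) \<partial>cell \<beta>) < \<infinity>"
    using i by (simp add: nn_integral_eq_integral)
qed simp

text \<open>Bessel's inequality is one half; density of the trigonometric polynomials in \<open>L\<^sup>2\<close> is the other.\<close>

theorem parseval_cell:
  assumes "\<beta> > 0" and f: "f \<in> borel_measurable (cell \<beta>)" "integrable (cell \<beta>) (\<lambda>x. (cmod (f x))\<^sup>2)"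
  shows "(\<integral>\<^sup>+x. ennreal ((cmod (f x))\<^sup>2) \<partial>cell \<beta>) =
    ennreal \<beta> * ell2_normsq_ext UNIV (\<lambda>k. LINT x|cell \<beta>. f x * cnj (fexp \<beta> k x))"
    (is "?I = _ * ell2_normsq_ext _ ?c")
proof (rule antisym)
  let ?E = "ell2_normsq_ext UNIV ?c"
  have I: "?I = ennreal (LINT x|cell \<beta>. (cmod (f x))\<^sup>2)"
    using f(2) by (subst nn_integral_eq_integral) auto
  note dist = integral_dist_trig_poly[OF \<open>\<beta> > 0\<close> f]
  have "?E \<le> ennreal ((LINT x|cell \<beta>. (cmod (f x))\<^sup>2) / \<beta>)"
  proof (rule ell2_normsq_ext_le, rule ennreal_leI)
    fix F :: "int set" assume F: "finite F"
    have "0 \<le> (LINT x|cell \<beta>. (cmod (f x - (\<Sum>k\<in>F. (\<beta> * ?c k) * fexp \<beta> k x)))\<^sup>2)"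
      by (intro integral_nonneg_AE) simp
    also have "\<dots> = (LINT x|cell \<beta>. (cmod (f x))\<^sup>2) - \<beta> * (\<Sum>k\<in>F. (cmod (?c k))\<^sup>2)"
      by (subst dist[OF F]) simp
    finally show "(\<Sum>k\<in>F. (cmod (?c k))\<^sup>2) \<le> (LINT x|cell \<beta>. (cmod (f x))\<^sup>2) / \<beta>"
      using \<open>\<beta> > 0\<close> by (simp add: field_simps)
  qed
  then have "ennreal \<beta> * ?E \<le> ennreal \<beta> * ennreal ((LINT x|cell \<beta>. (cmod (f x))\<^sup>2) / \<beta>)"
    by (rule mult_left_mono) simp
  also have "\<dots> = ?I" unfolding I using \<open>\<beta> > 0\<close> by (simp flip: ennreal_mult')
  finally show "ennreal \<beta> * ?E \<le> ?I" .
  show "?I \<le> ennreal \<beta> * ?E"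
  proof (rule ennreal_le_epsilon)
    fix e :: real assume "e > 0"
    then obtain p where p: "trig_poly \<beta> p" "(\<integral>\<^sup>+x. ennreal ((cmod (f x - p x))\<^sup>2) \<partial>cell \<beta>) < ennreal e"
      using L2_approximable_square_integrable[OF \<open>\<beta> > 0\<close> f] unfolding L2_approximable_def
      by (meson ennreal_less_zero_iff)
    obtain F a where F: "finite F" "p = (\<lambda>x. \<Sum>k\<in>F. a k * fexp \<beta> k x)"
      using p(1) unfolding trig_poly_def by blast
    note [measurable] = f(1) trig_poly_measurable[OF p(1)]
    have "integrable (cell \<beta>) (\<lambda>x. (cmod (f x - p x))\<^sup>2)"
      using p(2) by (intro integrableI_bounded) (auto simp: less_top[symmetric] intro: le_less_trans)
    then have "ennreal (LINT x|cell \<beta>. (cmod (f x - p x))\<^sup>2) < ennreal e"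
      using p(2) by (subst (asm) nn_integral_eq_integral) auto
    then have "(LINT x|cell \<beta>. (cmod (f x - p x))\<^sup>2) < e"
      using \<open>e > 0\<close> by (simp add: ennreal_less_iff integral_nonneg_AE)
    moreover have "(LINT x|cell \<beta>. (cmod (f x - p x))\<^sup>2) \<ge>
        (LINT x|cell \<beta>. (cmod (f x))\<^sup>2) - \<beta> * (\<Sum>k\<in>F. (cmod (?c k))\<^sup>2)"
      unfolding F(2) dist[OF F(1)] using \<open>\<beta> > 0\<close> by (simp add: sum_nonneg)
    ultimately have "?I \<le> ennreal (\<beta> * (\<Sum>k\<in>F. (cmod (?c k))\<^sup>2) + e)"
      unfolding I by (intro ennreal_leI) simp
    also have "\<dots> = ennreal \<beta> * ennreal (\<Sum>k\<in>F. (cmod (?c k))\<^sup>2) + ennreal e"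
      using \<open>\<beta> > 0\<close> \<open>e > 0\<close> by (simp add: ennreal_plus ennreal_mult' sum_nonneg del: sum_ennreal)
    also have "\<dots> \<le> ennreal \<beta> * ?E + ennreal e"
      by (intro add_right_mono mult_left_mono sum_le_ell2_normsq_ext F) auto
    finally show "?I \<le> ennreal \<beta> * ?E + ennreal e" .
  qed
qed

section \<open>Periodization and the fibers of a Gabor system\<close>

lemma translation_measurable_lebesgue [measurable]: "(\<lambda>x::real. x + t) \<in> lebesgue \<rightarrow>\<^sub>M lebesgue"
  using lebesgue_affine_measurable[of "\<lambda>_::real. 1" t] by (simp add: add.commute)

lemma measurable_translate:
  "f \<in> borel_measurable lebesgue \<Longrightarrow> (\<lambda>x::real. f (x + t)) \<in> borel_measurable lebesgue"
  by (rule measurable_compose[OF translation_measurable_lebesgue])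

lemma nn_integral_translate:
  fixes f :: "real \<Rightarrow> ennreal"
  assumes "f \<in> borel_measurable lebesgue"
  shows "(\<integral>\<^sup>+x. f (x + t) \<partial>lebesgue) = (\<integral>\<^sup>+x. f x \<partial>lebesgue)"
  using nn_integral_real_affine_lebesgue[OF assms, of 1 t] by (simp add: add.commute)

lemma cell_floor:
  assumes "\<beta> > 0"
  shows "x \<in> {0..<1/\<beta>} \<longleftrightarrow> \<lfloor>\<beta> * (x + of_int n / \<beta>)\<rfloor> = n"
proof -
  have "\<beta> * (x + of_int n / \<beta>) = \<beta> * x + of_int n" using assms by (simp add: field_simps)
  moreover have "x \<in> {0..<1/\<beta>} \<longleftrightarrow> 0 \<le> \<beta> * x \<and> \<beta> * x < 1"
    using assms by (auto simp: zero_le_mult_iff pos_less_divide_eq mult.commute)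
  ultimately show ?thesis by (simp add: floor_eq_iff add.commute)
qed

text \<open>The line is the disjoint union of the translates of one period, and each \<open>x\<close> lies in the translate
  with number \<open>\<lfloor>\<beta> * x\<rfloor>\<close>.\<close>

lemma nn_integral_tiling:
  fixes f :: "real \<Rightarrow> ennreal"
  assumes "\<beta> > 0" and f [measurable]: "f \<in> borel_measurable lebesgue"
  shows "(\<integral>\<^sup>+x. (\<integral>\<^sup>+n. f (x + of_int n / \<beta>) \<partial>count_space (UNIV :: int set)) \<partial>cell \<beta>) = (\<integral>\<^sup>+x. f x \<partial>lebesgue)"
proof -
  have [measurable]: "(\<lambda>x. indicator {\<lfloor>\<beta> * x\<rfloor>} n :: ennreal) \<in> borel_measurable lebesgue" for n
  proof -
    have "(\<lambda>x. indicator {\<lfloor>\<beta> * x\<rfloor>} n :: ennreal) \<in> borel_measurable borel" 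
      unfolding indicator_def by measurable
    then show ?thesis by (intro measurable_completion) simp
  qed
  have ind: "indicator {\<lfloor>\<beta> * (x + of_int n / \<beta>)\<rfloor>} n = (indicator {0..<1/\<beta>} x :: ennreal)" for x n
    using cell_floor[OF \<open>\<beta> > 0\<close>, of x n] by (auto simp: indicator_def simp del: atLeastLessThan_iff)
  have [measurable]: "(\<lambda>x. f (x + t)) \<in> borel_measurable lebesgue" for t
    by (rule measurable_translate[OF f])
  have "(\<integral>\<^sup>+x. f x \<partial>lebesgue) = (\<integral>\<^sup>+x. (\<integral>\<^sup>+n. f x * indicator {\<lfloor>\<beta> * x\<rfloor>} n \<partial>count_space (UNIV :: int set)) \<partial>lebesgue)"
    by (simp add: nn_integral_cmult)
  also have "\<dots> = (\<integral>\<^sup>+n. (\<integral>\<^sup>+x. f x * indicator {\<lfloor>\<beta> * x\<rfloor>} n \<partial>lebesgue) \<partial>count_space (UNIV :: int set))"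
    by (rule nn_integral_count_space_nn_integral) auto
  also have "\<dots> = (\<integral>\<^sup>+n. (\<integral>\<^sup>+x. f (x + of_int n / \<beta>) * indicator {\<lfloor>\<beta> * (x + of_int n / \<beta>)\<rfloor>} n \<partial>lebesgue) \<partial>count_space (UNIV :: int set))"
    by (intro nn_integral_cong nn_integral_translate[symmetric]) measurable
  also have "\<dots> = (\<integral>\<^sup>+n. (\<integral>\<^sup>+x. f (x + of_int n / \<beta>) * indicator {0..<1/\<beta>} x \<partial>lebesgue) \<partial>count_space (UNIV :: int set))"
    by (simp only: ind)
  also have "\<dots> = (\<integral>\<^sup>+n. (\<integral>\<^sup>+x. f (x + of_int n / \<beta>) \<partial>cell \<beta>) \<partial>count_space (UNIV :: int set))"
    by (simp add: nn_integral_restrict_space)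
  also have "\<dots> = (\<integral>\<^sup>+x. (\<integral>\<^sup>+n. f (x + of_int n / \<beta>) \<partial>count_space (UNIV :: int set)) \<partial>cell \<beta>)"
    by (rule nn_integral_count_space_nn_integral[symmetric]) (auto intro: measurable_restrict_space1)
  finally show ?thesis ..
qed

lemma sigma_finite_cell: "sigma_finite_measure (cell \<beta>)"
  using finite_measure_cell by (rule finite_measure.axioms)

lemma pair_sigma_finite_cell: "pair_sigma_finite (count_space (UNIV :: int set)) (cell \<beta>)"
  by (intro pair_sigma_finite.intro sigma_finite_measure_count_space sigma_finite_cell)

lemma shift_measurable:
  "(\<lambda>(n, x). x + of_int n / \<beta>) \<in> count_space (UNIV :: int set) \<Otimes>\<^sub>M cell \<beta> \<rightarrow>\<^sub>M lebesgue"
  by (rule measurable_pair_measure_countable1)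
     (auto intro!: measurable_restrict_space1 translation_measurable_lebesgue)

text \<open>Tiling restated as an equality of measures: Lebesgue measure is the image of counting measure times
  one period. In this form Fubini's theorem applies to complex functions as well.\<close>

lemma lebesgue_eq_distr_cell:
  assumes "\<beta> > 0"
  shows "distr (count_space (UNIV :: int set) \<Otimes>\<^sub>M cell \<beta>) lebesgue (\<lambda>(n, x). x + of_int n / \<beta>) = lebesgue"
proof (rule measure_eqI)
  interpret pair_sigma_finite "count_space (UNIV :: int set)" "cell \<beta>" by (rule pair_sigma_finite_cell)
  fix A assume "A \<in> sets (distr (count_space (UNIV :: int set) \<Otimes>\<^sub>M cell \<beta>) lebesgue (\<lambda>(n, x). x + of_int n / \<beta>))"
  then have A [measurable]: "A \<in> sets lebesgue" by simp
  note [measurable] = shift_measurable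
  have "emeasure (distr (count_space (UNIV :: int set) \<Otimes>\<^sub>M cell \<beta>) lebesgue (\<lambda>(n, x). x + of_int n / \<beta>)) A =
    (\<integral>\<^sup>+y. indicator A y \<partial>distr (count_space (UNIV :: int set) \<Otimes>\<^sub>M cell \<beta>) lebesgue (\<lambda>(n, x). x + of_int n / \<beta>))"
    by simp
  also have "\<dots> = (\<integral>\<^sup>+z. indicator A (case z of (n, x) \<Rightarrow> x + of_int n / \<beta>) \<partial>(count_space (UNIV :: int set) \<Otimes>\<^sub>M cell \<beta>))"
    by (rule nn_integral_distr) (auto intro: shift_measurable)
  also have "\<dots> = (\<integral>\<^sup>+x. (\<integral>\<^sup>+n. indicator A (x + of_int n / \<beta>) \<partial>count_space (UNIV :: int set)) \<partial>cell \<beta>)"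
    by (subst nn_integral_snd[symmetric]) auto
  also have "\<dots> = (\<integral>\<^sup>+x. indicator A x \<partial>lebesgue)"
    by (rule nn_integral_tiling[OF assms]) simp
  finally show "emeasure (distr (count_space (UNIV :: int set) \<Otimes>\<^sub>M cell \<beta>) lebesgue (\<lambda>(n, x). x + of_int n / \<beta>)) A = emeasure lebesgue A"
    by simp
qed simp

lemma periodization:
  fixes F :: "real \<Rightarrow> complex"
  assumes "\<beta> > 0" and F: "integrable lebesgue F"
  shows "(LINT x|cell \<beta>. (LINT n|count_space (UNIV :: int set). F (x + of_int n / \<beta>))) = (LINT x|lebesgue. F x)"
proof -
  interpret pair_sigma_finite "count_space (UNIV :: int set)" "cell \<beta>" by (rule pair_sigma_finite_cell)
  let ?P = "count_space (UNIV :: int set) \<Otimes>\<^sub>M cell \<beta>"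
  have m: "F \<in> borel_measurable lebesgue" using F by simp
  have "integrable (distr ?P lebesgue (\<lambda>(n, x). x + of_int n / \<beta>)) F"
    using F by (simp add: lebesgue_eq_distr_cell[OF assms(1)])
  then have int: "integrable ?P (\<lambda>(n, x). F (x + of_int n / \<beta>))"
    by (subst (asm) integrable_distr_eq[OF shift_measurable m]) (simp add: case_prod_unfold)
  have "(LINT x|lebesgue. F x) = (LINT x|distr ?P lebesgue (\<lambda>(n, x). x + of_int n / \<beta>). F x)"
    by (simp add: lebesgue_eq_distr_cell[OF assms(1)])
  also have "\<dots> = (LINT (n, x)|?P. F (x + of_int n / \<beta>))"
    by (subst integral_distr[OF shift_measurable m]) (simp add: case_prod_unfold)
  also have "\<dots> = (LINT x|cell \<beta>. (LINT n|count_space (UNIV :: int set). F (x + of_int n / \<beta>)))"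
    by (rule integral_snd[OF int, symmetric])
  finally show ?thesis ..
qed

lemma measurable_periodization:
  fixes F :: "real \<Rightarrow> complex"
  assumes "F \<in> borel_measurable lebesgue"
  shows "(\<lambda>x. LINT n|count_space (UNIV :: int set). F (x + of_int n / \<beta>)) \<in> borel_measurable (cell \<beta>)"
proof -
  interpret sigma_finite_measure "count_space (UNIV :: int set)" by (rule sigma_finite_measure_count_space)
  have "(\<lambda>(n, x). F (x + of_int n / \<beta>)) \<in> borel_measurable (count_space (UNIV :: int set) \<Otimes>\<^sub>M cell \<beta>)"
    using measurable_compose[OF shift_measurable assms] by (simp add: case_prod_unfold)
  then have "(\<lambda>(x, n). F (x + of_int n / \<beta>)) \<in> borel_measurable (cell \<beta> \<Otimes>\<^sub>M count_space (UNIV :: int set))"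
    by (subst (asm) measurable_pair_swap_iff) (simp add: case_prod_unfold)
  then show ?thesis by (rule borel_measurable_lebesgue_integral)
qed

text \<open>The vector to which the matrix at \<open>x\<close> is applied. The conjugate appears because the matrix contains
  \<open>g\<close> itself, whereas the inner products \<open>(h, \<pi>\<^bsub>t,\<omega>\<^esub> g)\<close> contain its conjugate.\<close>

definition fiber :: "real \<Rightarrow> (real \<Rightarrow> complex) \<Rightarrow> real \<Rightarrow> int \<Rightarrow> complex" where
  "fiber \<beta> h x n = cnj (h (x + of_int n / \<beta>))"

lemma fexp_periodic: 
  assumes "\<beta> > 0" shows "fexp \<beta> k (x + of_int n / \<beta>) = fexp \<beta> k x"
proof -
  have "2 * pi * (\<beta> * of_int k) * (x + of_int n / \<beta>) = 2 * pi * (\<beta> * of_int k) * x + 2 * pi * of_int (k * n)"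
    using assms by (simp add: field_simps)
  moreover have "cis (2 * pi * of_int (k * n)) = 1" by (rule cis_multiple_2pi) simp
  ultimately show ?thesis unfolding fexp_def by (simp only: flip: cis_mult) simp
qed

text \<open>Up to the factor \<open>fexp \<beta> k\<close>, the conjugate of the integrand of the coefficient of \<open>h\<close> at the point
  \<open>(l, \<beta> * k + c l)\<close>.\<close>

definition row_product :: "(real \<Rightarrow> complex) \<Rightarrow> (real \<Rightarrow> real) \<Rightarrow> (real \<Rightarrow> complex) \<Rightarrow> real \<Rightarrow> real \<Rightarrow> complex" where
  "row_product g c h l x = g (x - l) * cis (2 * pi * c l * x) * cnj (h x)"

lemma L2D: assumes "f \<in> L2"
  shows "f \<in> borel_measurable lebesgue" "integrable lebesgue (\<lambda>x. (cmod (f x))\<^sup>2)"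
  using assms by (auto simp: L2_def)

lemma L2_translate: assumes "f \<in> L2" shows "(\<lambda>x. f (x + t)) \<in> L2"
proof -
  have "integrable lebesgue (\<lambda>x. (cmod (f (x + t)))\<^sup>2)"
  proof -
    note L2D(1)[OF assms, measurable]
    have "(\<integral>\<^sup>+x. ennreal ((cmod (f (x + t)))\<^sup>2) \<partial>lebesgue) = (\<integral>\<^sup>+x. ennreal ((cmod (f x))\<^sup>2) \<partial>lebesgue)"
      by (rule nn_integral_translate[of "\<lambda>x. ennreal ((cmod (f x))\<^sup>2)"]) simp
    also have "\<dots> < \<infinity>" using L2D[OF assms] by (simp add: nn_integral_eq_integral)
    finally show ?thesis
      by (intro integrableI_bounded) (use measurable_translate[OF L2D(1)[OF assms], of t] in auto)
  qed
  then show ?thesis using measurable_translate[OF L2D(1)[OF assms]] by (simp add: L2_def)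
qed

lemma cis_measurable_lebesgue: "(\<lambda>x. cis (a * x)) \<in> borel_measurable lebesgue"
  by (intro measurable_completion) (simp add: cis_conv_exp borel_measurable_continuous_onI continuous_intros)

lemma row_product_measurable:
  assumes "g \<in> L2" "h \<in> L2" shows "row_product g c h l \<in> borel_measurable lebesgue"
  unfolding row_product_def
  using L2D(1)[OF L2_translate[OF assms(1), of "- l"]] L2D(1)[OF assms(2)] cis_measurable_lebesgue[of "2 * pi * c l"]
  by (intro borel_measurable_times borel_measurable_cnj) simp_all

lemma row_product_integrable:
  assumes "g \<in> L2" "h \<in> L2" shows "integrable lebesgue (row_product g c h l)"
proof -
  note g = L2_translate[OF assms(1), of "- l"]
  have "integrable lebesgue (\<lambda>x. (g (x + - l) * cis (2 * pi * c l * x)) * cnj (h x))"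
    using L2D[OF g] L2D[OF assms(2)] cis_measurable_lebesgue[of "2 * pi * c l"]
    by (intro integrable_mult_L2) (simp_all add: norm_mult borel_measurable_times borel_measurable_cnj)
  then show ?thesis unfolding row_product_def[abs_def] by simp
qed

text \<open>The frequencies over \<open>l\<close> lie in one coset of \<open>\<beta>\<int>\<close>, and \<open>fexp \<beta> k\<close> has period \<open>1/\<beta>\<close>. So the
  coefficients over \<open>l\<close> are the Fourier coefficients of one periodized function.\<close>

lemma gabor_coeff_eq_Fourier:
  assumes "\<beta> > 0" "g \<in> L2" "h \<in> L2"
  shows "gabor_coeff g h (l, \<beta> * of_int k + c l) =
    cnj (LINT x|cell \<beta>. (LINT n|count_space (UNIV::int set). row_product g c h l (x + of_int n / \<beta>)) * cnj (fexp \<beta> (- k) x))"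
proof -
  have int: "integrable lebesgue (\<lambda>x. row_product g c h l x * fexp \<beta> k x)"
  proof (rule Bochner_Integration.integrable_bound[OF row_product_integrable[OF assms(2,3), of c l]])
    have "fexp \<beta> k \<in> borel_measurable lebesgue" by (intro measurable_completion) simp
    then show "(\<lambda>x. row_product g c h l x * fexp \<beta> k x) \<in> borel_measurable lebesgue"
      by (intro borel_measurable_times row_product_measurable[OF assms(2,3)])
  qed (simp add: norm_mult)
  have "gabor_coeff g h (l, \<beta> * of_int k + c l) = (LINT x|lebesgue. cnj (row_product g c h l x * fexp \<beta> k x))"
    unfolding gabor_coeff_def L2_inner_def time_freq_shift_def row_product_def fexp_def
    by (simp add: cis_mult algebra_simps flip: cis_mult)
  also have "\<dots> = cnj (LINT x|lebesgue. row_product g c h l x * fexp \<beta> k x)"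
    by (rule Bochner_Integration.integral_cnj)
  also have "(LINT x|lebesgue. row_product g c h l x * fexp \<beta> k x) =
     (LINT x|cell \<beta>. (LINT n|count_space (UNIV::int set). row_product g c h l (x + of_int n / \<beta>) * fexp \<beta> k (x + of_int n / \<beta>)))"
    by (rule periodization[OF assms(1) int, symmetric])
  finally show ?thesis by (simp add: fexp_periodic[OF assms(1)] cnj_fexp)
qed

text \<open>The periodized function of the row \<open>l\<close> is, up to a unimodular factor, the entry \<open>l\<close> of
  the matrix applied to the fiber.\<close>

lemma gabor_matrix_apply_fiber:
  assumes "\<beta> > 0"
  shows "(LINT n|count_space (UNIV::int set). row_product g c h l (x + of_int n / \<beta>)) =
    cis (2 * pi * c l * x) * gabor_matrix_apply \<beta> g c x (fiber \<beta> h x) l"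
  unfolding gabor_matrix_apply_def infsum_complex_eq_lebesgue_integral[symmetric] infsum_cmult_right'[symmetric]
  by (intro infsum_cong) (simp add: row_product_def gabor_matrix_def fiber_def ring_distribs algebra_simps flip: cis_mult)

lemma gabor_matrix_apply_fiber_measurable:
  assumes "\<beta> > 0" "g \<in> L2" "h \<in> L2"
  shows "(\<lambda>x. gabor_matrix_apply \<beta> g c x (fiber \<beta> h x) l) \<in> borel_measurable (cell \<beta>)"
proof -
  have "gabor_matrix_apply \<beta> g c x (fiber \<beta> h x) l =
     cis (- (2 * pi * c l) * x) * (LINT n|count_space (UNIV::int set). row_product g c h l (x + of_int n / \<beta>))" for x
    unfolding gabor_matrix_apply_fiber[OF assms(1)] mult.assoc[symmetric] cis_mult by simp
  then show ?thesis
    by (simp only:) (intro borel_measurable_times measurable_periodization row_product_measurable assms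
       measurable_restrict_space1[OF cis_measurable_lebesgue])
qed

text \<open>Parseval's identity for the periodized function. The sign in \<open>fexp \<beta> (- k)\<close> is absorbed by reindexing
  the sum.\<close>

lemma row_coefficients:
  assumes "\<beta> > 0" "g \<in> L2" "h \<in> L2"
    and "integrable (cell \<beta>) (\<lambda>x. (cmod (gabor_matrix_apply \<beta> g c x (fiber \<beta> h x) l))\<^sup>2)"
  shows "(\<integral>\<^sup>+x. ennreal ((cmod (gabor_matrix_apply \<beta> g c x (fiber \<beta> h x) l))\<^sup>2) \<partial>cell \<beta>) =
    ennreal \<beta> * ell2_normsq_ext UNIV (\<lambda>k. gabor_coeff g h (l, \<beta> * of_int k + c l))"
proof -
  define P where "P x = (LINT n|count_space (UNIV::int set). row_product g c h l (x + of_int n / \<beta>))" for x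
  have n: "cmod (gabor_matrix_apply \<beta> g c x (fiber \<beta> h x) l) = cmod (P x)" for x
    unfolding P_def gabor_matrix_apply_fiber[OF assms(1)] by (simp add: norm_mult)
  have Pm: "P \<in> borel_measurable (cell \<beta>)"
    unfolding P_def by (intro measurable_periodization row_product_measurable assms)
  have "ell2_normsq_ext UNIV (\<lambda>k. LINT x|cell \<beta>. P x * cnj (fexp \<beta> k x)) =
    (\<Sum>\<^sub>\<infinity>k. ennreal ((cmod (LINT x|cell \<beta>. P x * cnj (fexp \<beta> (- k) x)))\<^sup>2))"
    unfolding ell2_normsq_ext_def
    by (rule infsum_reindex_bij_betw[symmetric]) (rule bij_uminus)
  also have "\<dots> = ell2_normsq_ext UNIV (\<lambda>k. gabor_coeff g h (l, \<beta> * of_int k + c l))"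
    unfolding ell2_normsq_ext_def gabor_coeff_eq_Fourier[OF assms(1-3)] P_def by simp
  finally show ?thesis
    using parseval_cell[OF assms(1) Pm] assms(4) unfolding n by simp
qed

lemma ell2_normsq_ext_semi_regular_set:
  assumes "\<beta> > 0" "countable \<Lambda>"
  shows "ell2_normsq_ext (semi_regular_set \<beta> \<Lambda> c) u =
    (\<integral>\<^sup>+l. ell2_normsq_ext UNIV (\<lambda>k::int. u (l, \<beta> * of_int k + c l)) \<partial>count_space \<Lambda>)"
proof -
  let ?m = "\<lambda>(l, k::int). (l, \<beta> * of_int k + c l)"
  interpret sigma_finite_measure "count_space (UNIV :: int set)" by (rule sigma_finite_measure_count_space)
  have bij: "bij_betw ?m (\<Lambda> \<times> UNIV) (semi_regular_set \<beta> \<Lambda> c)"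
    using assms(1) unfolding bij_betw_def semi_regular_set_def by (auto simp: inj_on_def image_iff)
  have cnt: "countable (semi_regular_set \<beta> \<Lambda> c)"
    using assms(2) unfolding semi_regular_set_def by auto
  have pair: "count_space \<Lambda> \<Otimes>\<^sub>M count_space (UNIV :: int set) = count_space (\<Lambda> \<times> UNIV)"
    using assms(2) by (intro pair_measure_countable) auto
  have "ell2_normsq_ext (semi_regular_set \<beta> \<Lambda> c) u = (\<integral>\<^sup>+z. ennreal ((cmod (u (?m z)))\<^sup>2) \<partial>count_space (\<Lambda> \<times> UNIV))"
    unfolding ell2_normsq_ext_eq_nn_integral[OF cnt] by (rule nn_integral_bij_count_space[OF bij, symmetric])
  also have "\<dots> = (\<integral>\<^sup>+l. (\<integral>\<^sup>+k. ennreal ((cmod (u (?m (l, k))))\<^sup>2) \<partial>count_space UNIV) \<partial>count_space \<Lambda>)"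
    using nn_integral_fst[of "\<lambda>z. ennreal ((cmod (u (?m z)))\<^sup>2)" "count_space \<Lambda>"] by (simp only: pair) simp
  finally show ?thesis by (simp add: ell2_normsq_ext_eq_nn_integral)
qed

text \<open>The identity behind both directions: the sum of the squared coefficients is an integral over one
  period, whose integrand at \<open>x\<close> depends on \<open>h\<close> through the fiber at \<open>x\<close> alone. The rows are assumed square integrable because Parseval's identity is used for
  square integrable functions; each direction verifies this in its own way.\<close>

theorem fiber_identity:
  assumes "\<beta> > 0" "g \<in> L2" "h \<in> L2" "countable \<Lambda>"
    and "\<And>l. l \<in> \<Lambda> \<Longrightarrow> integrable (cell \<beta>) (\<lambda>x. (cmod (gabor_matrix_apply \<beta> g c x (fiber \<beta> h x) l))\<^sup>2)"
  shows "(\<integral>\<^sup>+x. ell2_normsq_ext \<Lambda> (gabor_matrix_apply \<beta> g c x (fiber \<beta> h x)) \<partial>cell \<beta>) =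
    ennreal \<beta> * ell2_normsq_ext (semi_regular_set \<beta> \<Lambda> c) (gabor_coeff g h)"
proof -
  note [measurable] = gabor_matrix_apply_fiber_measurable[OF assms(1-3)]
  have "(\<integral>\<^sup>+x. ell2_normsq_ext \<Lambda> (gabor_matrix_apply \<beta> g c x (fiber \<beta> h x)) \<partial>cell \<beta>) =
    (\<integral>\<^sup>+l. (\<integral>\<^sup>+x. ennreal ((cmod (gabor_matrix_apply \<beta> g c x (fiber \<beta> h x) l))\<^sup>2) \<partial>cell \<beta>) \<partial>count_space \<Lambda>)"
    unfolding ell2_normsq_ext_eq_nn_integral[OF assms(4)]
    by (rule nn_integral_count_space_nn_integral[OF assms(4)]) measurable
  also have "\<dots> = (\<integral>\<^sup>+l. ennreal \<beta> * ell2_normsq_ext UNIV (\<lambda>k. gabor_coeff g h (l, \<beta> * of_int k + c l)) \<partial>count_space \<Lambda>)"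
    by (intro nn_integral_cong row_coefficients assms) auto
  finally show ?thesis
    by (simp add: nn_integral_cmult ell2_normsq_ext_semi_regular_set[OF assms(1,4)])
qed

lemma fiber_norm:
  assumes "\<beta> > 0" "h \<in> L2"
  shows "(\<integral>\<^sup>+x. ell2_normsq_ext UNIV (fiber \<beta> h x) \<partial>cell \<beta>) = ennreal ((L2_norm h)\<^sup>2)"
proof -
  note L2D(1)[OF assms(2), measurable]
  show ?thesis
    unfolding L2_norm_eq_nn_integral[OF assms(2)] ell2_normsq_ext_eq_nn_integral[OF countableI_type] fiber_def
    by (simp add: nn_integral_tiling[OF assms(1), of "\<lambda>x. ennreal ((cmod (h x))\<^sup>2)"])
qed

section \<open>From matrix bounds to frame bounds\<close>

text \<open>A countable supremum of finite sums, as a countable set has countably many finite subsets.\<close>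

lemma ell2_normsq_ext_measurable:
  assumes "countable I" and m: "\<And>i. i \<in> I \<Longrightarrow> (\<lambda>x. v x i) \<in> borel_measurable M"
  shows "(\<lambda>x. ell2_normsq_ext I (v x)) \<in> borel_measurable M"
  unfolding ell2_normsq_ext_eq_SUP
proof (rule borel_measurable_SUP)
  show "countable {F. finite F \<and> F \<subseteq> I}" using countable_Collect_finite_subset[OF assms(1)] by (simp add: conj_commute)
  fix F assume "F \<in> {F. finite F \<and> F \<subseteq> I}"
  then have [measurable]: "(\<lambda>x. v x i) \<in> borel_measurable M" if "i \<in> F" for i using that m by auto
  show "(\<lambda>x. ennreal (\<Sum>i\<in>F. (cmod (v x i))\<^sup>2)) \<in> borel_measurable M" by measurable
qed

lemma fiber_measurable:
  assumes "h \<in> L2" shows "(\<lambda>x. fiber \<beta> h x n) \<in> borel_measurable (cell \<beta>)"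
  unfolding fiber_def
  by (intro borel_measurable_cnj measurable_restrict_space1 measurable_translate L2D(1) assms)

lemma AE_fiber_ell2:
  assumes "\<beta> > 0" "h \<in> L2"
  shows "AE x in cell \<beta>. fiber \<beta> h x \<in> ell2 UNIV"
proof -
  have "AE x in cell \<beta>. ell2_normsq_ext UNIV (fiber \<beta> h x) \<noteq> \<infinity>"
    by (rule nn_integral_PInf_AE)
       (use fiber_measurable[OF assms(2)] in \<open>auto intro: ell2_normsq_ext_measurable simp: fiber_norm[OF assms]\<close>)
  then show ?thesis by (simp add: ell2_iff less_top)
qed

lemma AE_cellI: "AE x in lebesgue. P x \<Longrightarrow> AE x in cell \<beta>. P x"
  by (subst AE_restrict_space_iff) auto

lemma single_le_ell2_normsq_ext: "i \<in> I \<Longrightarrow> ennreal ((cmod (v i))\<^sup>2) \<le> ell2_normsq_ext I v"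
  using sum_le_ell2_normsq_ext[of "{i}" I v] by simp

text \<open>An upper bound for the matrices dominates each row, applied to the fibers of \<open>h\<close>, by the square
  integrable norm of the fiber. This is the integrability that \<open>fiber_identity\<close> asks for.\<close>

lemma upper_matrix_bound_imp_row_integrable:
  assumes "\<beta> > 0" "g \<in> L2" "h \<in> L2" "B > 0"
    and ub: "AE x in lebesgue. \<forall>v\<in>ell2 UNIV.
      ell2_normsq_ext \<Lambda> (gabor_matrix_apply \<beta> g c x v) \<le> ennreal (B * \<beta> * (ell2_norm UNIV v)\<^sup>2)"
  shows "(\<integral>\<^sup>+x. ell2_normsq_ext \<Lambda> (gabor_matrix_apply \<beta> g c x (fiber \<beta> h x)) \<partial>cell \<beta>) \<le> ennreal \<beta> * ennreal (B * (L2_norm h)\<^sup>2)"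
    and "l \<in> \<Lambda> \<Longrightarrow> integrable (cell \<beta>) (\<lambda>x. (cmod (gabor_matrix_apply \<beta> g c x (fiber \<beta> h x) l))\<^sup>2)"
proof -
  let ?G = "\<lambda>x. gabor_matrix_apply \<beta> g c x (fiber \<beta> h x)"
  have "AE x in cell \<beta>. ell2_normsq_ext \<Lambda> (?G x) \<le> ennreal (B * \<beta>) * ell2_normsq_ext UNIV (fiber \<beta> h x)"
    using AE_cellI[OF ub] AE_fiber_ell2[OF assms(1,3)]
    by eventually_elim (use assms(1,4) in \<open>simp add: ell2_normsq_ext_ell2 ennreal_mult'\<close>)
  then have "(\<integral>\<^sup>+x. ell2_normsq_ext \<Lambda> (?G x) \<partial>cell \<beta>) \<le> (\<integral>\<^sup>+x. ennreal (B * \<beta>) * ell2_normsq_ext UNIV (fiber \<beta> h x) \<partial>cell \<beta>)"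
    by (rule nn_integral_mono_AE)
  also have "\<dots> = ennreal (B * \<beta>) * ennreal ((L2_norm h)\<^sup>2)"
    by (subst nn_integral_cmult) (use fiber_measurable[OF assms(3)] in \<open>auto intro: ell2_normsq_ext_measurable simp: fiber_norm[OF assms(1,3)]\<close>)
  also have "\<dots> = ennreal \<beta> * ennreal (B * (L2_norm h)\<^sup>2)"
    using assms by (simp add: mult_ac flip: ennreal_mult')
  finally show *: "(\<integral>\<^sup>+x. ell2_normsq_ext \<Lambda> (?G x) \<partial>cell \<beta>) \<le> ennreal \<beta> * ennreal (B * (L2_norm h)\<^sup>2)" .
  show "integrable (cell \<beta>) (\<lambda>x. (cmod (?G x l))\<^sup>2)" if "l \<in> \<Lambda>"
  proof (rule integrableI_bounded)
    show "(\<lambda>x. (cmod (?G x l))\<^sup>2) \<in> borel_measurable (cell \<beta>)"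
      using gabor_matrix_apply_fiber_measurable[OF assms(1-3)] by measurable
    have "(\<integral>\<^sup>+x. ennreal (norm ((cmod (?G x l))\<^sup>2)) \<partial>cell \<beta>) \<le> (\<integral>\<^sup>+x. ell2_normsq_ext \<Lambda> (?G x) \<partial>cell \<beta>)"
      using that by (intro nn_integral_mono) (simp add: single_le_ell2_normsq_ext)
    also note *
    also have "ennreal \<beta> * ennreal (B * (L2_norm h)\<^sup>2) < \<infinity>" by (simp add: ennreal_mult_less_top)
    finally show "(\<integral>\<^sup>+x. ennreal (norm ((cmod (?G x l))\<^sup>2)) \<partial>cell \<beta>) < \<infinity>" .
  qed
qed

lemma upper_matrix_bounds_imp_frame:
  assumes "\<beta> > 0" "g \<in> L2" "countable \<Lambda>" "B \<in> upper_matrix_bounds \<beta> g \<Lambda> c"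
  shows "B \<in> upper_frame_bounds g (semi_regular_set \<beta> \<Lambda> c)"
proof -
  have B: "B > 0" and ub: "AE x in lebesgue. \<forall>v\<in>ell2 UNIV.
      ell2_normsq_ext \<Lambda> (gabor_matrix_apply \<beta> g c x v) \<le> ennreal (B * \<beta> * (ell2_norm UNIV v)\<^sup>2)"
    using assms(4) by (auto simp: upper_matrix_bounds_def)
  have "ell2_normsq_ext (semi_regular_set \<beta> \<Lambda> c) (gabor_coeff g h) \<le> ennreal (B * (L2_norm h)\<^sup>2)" if h: "h \<in> L2" for h
    using upper_matrix_bound_imp_row_integrable(1)[OF assms(1,2) h B ub] \<open>\<beta> > 0\<close>
      fiber_identity[OF assms(1,2) h assms(3) upper_matrix_bound_imp_row_integrable(2)[OF assms(1,2) h B ub]]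
    by (simp add: ennreal_mult_le_mult_iff)
  with B show ?thesis by (simp add: upper_frame_bounds_def)
qed

text \<open>The upper bound \<open>B\<close> makes the rows square integrable, so that Parseval's identity applies to them.\<close>

lemma lower_matrix_bounds_imp_frame:
  assumes "\<beta> > 0" "g \<in> L2" "countable \<Lambda>" "B \<in> upper_matrix_bounds \<beta> g \<Lambda> c" "A \<in> lower_matrix_bounds \<beta> g \<Lambda> c"
  shows "A \<in> lower_frame_bounds g (semi_regular_set \<beta> \<Lambda> c)"
proof -
  have B: "B > 0" and ub: "AE x in lebesgue. \<forall>v\<in>ell2 UNIV.
      ell2_normsq_ext \<Lambda> (gabor_matrix_apply \<beta> g c x v) \<le> ennreal (B * \<beta> * (ell2_norm UNIV v)\<^sup>2)"
    using assms(4) by (auto simp: upper_matrix_bounds_def)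
  have A: "A > 0" and lb: "AE x in lebesgue. \<forall>v\<in>ell2 UNIV.
      ennreal (A * \<beta> * (ell2_norm UNIV v)\<^sup>2) \<le> ell2_normsq_ext \<Lambda> (gabor_matrix_apply \<beta> g c x v)"
    using assms(5) by (auto simp: lower_matrix_bounds_def)
  have "ennreal (A * (L2_norm h)\<^sup>2) \<le> ell2_normsq_ext (semi_regular_set \<beta> \<Lambda> c) (gabor_coeff g h)" if h: "h \<in> L2" for h
  proof -
    have "ennreal \<beta> * ennreal (A * (L2_norm h)\<^sup>2) = ennreal (A * \<beta>) * ennreal ((L2_norm h)\<^sup>2)"
      using \<open>\<beta> > 0\<close> A by (simp add: mult_ac flip: ennreal_mult')
    also have "\<dots> = (\<integral>\<^sup>+x. ennreal (A * \<beta>) * ell2_normsq_ext UNIV (fiber \<beta> h x) \<partial>cell \<beta>)"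
      by (subst nn_integral_cmult) (use fiber_measurable[OF h] in \<open>auto intro: ell2_normsq_ext_measurable simp: fiber_norm[OF assms(1) h]\<close>)
    also have "\<dots> \<le> (\<integral>\<^sup>+x. ell2_normsq_ext \<Lambda> (gabor_matrix_apply \<beta> g c x (fiber \<beta> h x)) \<partial>cell \<beta>)"
    proof (rule nn_integral_mono_AE)
      show "AE x in cell \<beta>. ennreal (A * \<beta>) * ell2_normsq_ext UNIV (fiber \<beta> h x) \<le> ell2_normsq_ext \<Lambda> (gabor_matrix_apply \<beta> g c x (fiber \<beta> h x))"
        using AE_cellI[OF lb] AE_fiber_ell2[OF assms(1) h]
        by eventually_elim (use assms(1) A in \<open>simp add: ell2_normsq_ext_ell2 ennreal_mult'\<close>)
    qed
    also have "\<dots> = ennreal \<beta> * ell2_normsq_ext (semi_regular_set \<beta> \<Lambda> c) (gabor_coeff g h)"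
      by (rule fiber_identity[OF assms(1,2) h assms(3) upper_matrix_bound_imp_row_integrable(2)[OF assms(1,2) h B ub]])
    finally show ?thesis using \<open>\<beta> > 0\<close> by (simp add: ennreal_mult_le_mult_iff)
  qed
  with A show ?thesis by (simp add: lower_frame_bounds_def)
qed

section \<open>Extending matrix bounds from a dense set\<close>

lemma ell2_iff_integrable:
  "v \<in> ell2 I \<longleftrightarrow> integrable (count_space I) (\<lambda>i. (cmod (v i))\<^sup>2)"
proof -
  have "(\<lambda>i. norm ((cmod (v i))\<^sup>2)) summable_on I \<longleftrightarrow> integrable (count_space I) (\<lambda>i. (cmod (v i))\<^sup>2)"
    unfolding abs_summable_equivalent by (simp add: Infinite_Set_Sum.abs_summable_on_def)
  then show ?thesis by (simp add: ell2_def)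
qed

lemma ell2_mult_summable:
  assumes "u \<in> ell2 I" "v \<in> ell2 I" shows "(\<lambda>i. u i * v i) summable_on I"
proof -
  have "integrable (count_space I) (\<lambda>i. u i * v i)"
    using assms by (intro integrable_mult_L2) (simp_all add: ell2_iff_integrable)
  then show ?thesis
    unfolding summable_on_iff_abs_summable_on_complex abs_summable_equivalent
    by (simp add: Infinite_Set_Sum.abs_summable_on_def)
qed

lemma Cauchy_Schwarz_infsum:
  fixes u v :: "'i \<Rightarrow> complex"
  assumes "countable I"
  shows "ennreal ((cmod (\<Sum>\<^sub>\<infinity>i\<in>I. u i * v i))\<^sup>2) \<le> ell2_normsq_ext I u * ell2_normsq_ext I v"
proof -
  have "ennreal (cmod (\<Sum>\<^sub>\<infinity>i\<in>I. u i * v i)) \<le> (\<integral>\<^sup>+i. ennreal (cmod (u i)) * ennreal (cmod (v i)) \<partial>count_space I)"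
  proof (cases "integrable (count_space I) (\<lambda>i. u i * v i)")
    case True
    then show ?thesis
      using integral_norm_bound_ennreal[OF True]
      by (simp add: infsum_complex_eq_lebesgue_integral norm_mult ennreal_mult')
  qed (simp add: infsum_complex_eq_lebesgue_integral not_integrable_integral_eq)
  then have "(ennreal (cmod (\<Sum>\<^sub>\<infinity>i\<in>I. u i * v i)))\<^sup>2 \<le> (\<integral>\<^sup>+i. ennreal (cmod (u i)) * ennreal (cmod (v i)) \<partial>count_space I)\<^sup>2"
    by (rule power_mono) simp
  also have "\<dots> \<le> (\<integral>\<^sup>+i. (ennreal (cmod (u i)))\<^sup>2 \<partial>count_space I) * (\<integral>\<^sup>+i. (ennreal (cmod (v i)))\<^sup>2 \<partial>count_space I)"
    by (rule Cauchy_Schwarz_nn_integral) simp_all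
  finally show ?thesis by (simp add: ell2_normsq_ext_eq_nn_integral[OF assms] ennreal_power)
qed

text \<open>The triangle inequality for squares, with a factor \<open>1 + e\<close> that can be sent to \<open>1\<close>. Unlike the
  triangle inequality for norms it can be summed termwise with values in \<open>[0,\<infinity>]\<close>.\<close>

lemma cmod_square_le_eps:
  assumes "e > 0"
  shows "(cmod a)\<^sup>2 \<le> (1 + e) * (cmod b)\<^sup>2 + (1 + 1 / e) * (cmod (a - b))\<^sup>2"
proof -
  have "cmod a \<le> cmod b + cmod (a - b)" using norm_triangle_ineq[of b "a - b"] by simp
  then have "(cmod a)\<^sup>2 \<le> (cmod b + cmod (a - b))\<^sup>2" by (rule power_mono) simp
  also have "\<dots> = (cmod b)\<^sup>2 + 2 * cmod b * cmod (a - b) + (cmod (a - b))\<^sup>2" by (simp add: power2_sum)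
  also have "2 * cmod b * cmod (a - b) \<le> e * (cmod b)\<^sup>2 + (1 / e) * (cmod (a - b))\<^sup>2"
  proof -
    have "0 \<le> (e * cmod b - cmod (a - b))\<^sup>2 / e" using assms by simp
    also have "\<dots> = e * (cmod b)\<^sup>2 + (1 / e) * (cmod (a - b))\<^sup>2 - 2 * cmod b * cmod (a - b)"
      using assms by (simp add: power2_eq_square field_simps)
    finally show ?thesis by simp
  qed
  finally show ?thesis by (simp add: algebra_simps)
qed

lemma ell2_normsq_ext_le_eps:
  assumes "e > 0" "countable I"
  shows "ell2_normsq_ext I u \<le> ennreal (1 + e) * ell2_normsq_ext I w + ennreal (1 + 1 / e) * ell2_normsq_ext I (\<lambda>i. u i - w i)"
proof -
  have "ell2_normsq_ext I u \<le> (\<integral>\<^sup>+i. ennreal (1 + e) * ennreal ((cmod (w i))\<^sup>2) + ennreal (1 + 1 / e) * ennreal ((cmod (u i - w i))\<^sup>2) \<partial>count_space I)"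
    unfolding ell2_normsq_ext_eq_nn_integral[OF assms(2)]
  proof (rule nn_integral_mono)
    fix i
    have "ennreal ((cmod (u i))\<^sup>2) \<le> ennreal ((1 + e) * (cmod (w i))\<^sup>2 + (1 + 1 / e) * (cmod (u i - w i))\<^sup>2)"
      by (intro ennreal_leI cmod_square_le_eps assms)
    then show "ennreal ((cmod (u i))\<^sup>2) \<le> ennreal (1 + e) * ennreal ((cmod (w i))\<^sup>2) + ennreal (1 + 1 / e) * ennreal ((cmod (u i - w i))\<^sup>2)"
      using \<open>e > 0\<close> by (simp add: ennreal_plus ennreal_mult del: ennreal_plus[symmetric])
  qed
  also have "\<dots> = ennreal (1 + e) * ell2_normsq_ext I w + ennreal (1 + 1 / e) * ell2_normsq_ext I (\<lambda>i. u i - w i)"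
    by (simp add: nn_integral_add nn_integral_cmult ell2_normsq_ext_eq_nn_integral[OF assms(2)])
  finally show ?thesis .
qed

lemma ennreal_le_add_small:
  fixes x a c :: ennreal
  assumes "c < \<infinity>" and le: "\<And>d. d > 0 \<Longrightarrow> x \<le> a + c * ennreal d"
  shows "x \<le> a"
proof (rule ennreal_le_epsilon)
  fix e :: real assume "e > 0"
  obtain r where r: "r \<ge> 0" "c = ennreal r" using assms(1) by (cases c) auto
  have "x \<le> a + c * ennreal (e / (r + 1))" using r \<open>e > 0\<close> by (intro le) simp
  also have "c * ennreal (e / (r + 1)) = ennreal (r * (e / (r + 1)))"
    unfolding r(2) using r \<open>e > 0\<close> by (subst ennreal_mult) auto
  also have "\<dots> \<le> ennreal e" using r \<open>e > 0\<close> by (intro ennreal_leI) (simp add: field_simps)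
  finally show "x \<le> a + ennreal e" by (simp add: add_left_mono)
qed

lemma ennreal_le_mult_eps:
  fixes x a :: ennreal
  assumes le: "\<And>e. e > 0 \<Longrightarrow> x \<le> ennreal (1 + e) * a"
  shows "x \<le> a"
proof (cases "a = \<infinity>")
  case False
  show ?thesis
  proof (rule ennreal_le_add_small[of a])
    fix e :: real assume "e > 0"
    have "x \<le> ennreal (1 + e) * a" by (rule le[OF \<open>e > 0\<close>])
    also have "\<dots> = a + a * ennreal e" using \<open>e > 0\<close> by (simp add: ennreal_plus distrib_left mult.commute[of _ a])
    finally show "x \<le> a + a * ennreal e" .
  qed (use False in \<open>simp add: less_top\<close>)
qed simp

lemma ell2_normsq_ext_minus_commute:
  "ell2_normsq_ext I (\<lambda>i. u i - w i) = ell2_normsq_ext I (\<lambda>i. w i - u i)"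
  by (simp add: ell2_normsq_ext_def norm_minus_commute)

lemma ell2_diff:
  assumes "countable I" "u \<in> ell2 I" "w \<in> ell2 I" shows "(\<lambda>i. u i - w i) \<in> ell2 I"
proof -
  have "ell2_normsq_ext I (\<lambda>i. u i - w i) \<le> 2 * ell2_normsq_ext I u + 2 * ell2_normsq_ext I w"
    using ell2_normsq_ext_le_eps[of 1 I "\<lambda>i. u i - w i" u] assms
    by (simp add: ell2_normsq_ext_def)
  also have "\<dots> < \<infinity>" using assms by (simp add: ell2_iff ennreal_mult_less_top)
  finally show ?thesis by (simp add: ell2_iff)
qed

text \<open>Bounds on a dense set of vectors extend to all of \<open>\<ell>\<^sup>2\<close>. For the upper bound it is enough to treat
  finitely many rows at a time, on which the matrix is continuous by the Cauchy-Schwarz inequality. The upper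
  bound then makes the whole matrix continuous, and the lower bound follows.\<close>

lemma matrix_bounds_dense_extend:
  fixes M :: "'l \<Rightarrow> 'i \<Rightarrow> complex" and D :: "('i \<Rightarrow> complex) set"
    and T :: "('i \<Rightarrow> complex) \<Rightarrow> 'l \<Rightarrow> complex"
  assumes T: "\<And>v l. T v l = (\<Sum>\<^sub>\<infinity>i. M l i * v i)"
    and cnt: "countable L" "countable (UNIV :: 'i set)"
    and rows: "\<And>l. l \<in> L \<Longrightarrow> M l \<in> ell2 UNIV"
    and D: "D \<subseteq> ell2 UNIV"
    and dense: "\<And>v d. v \<in> ell2 UNIV \<Longrightarrow> d > 0 \<Longrightarrow> \<exists>w\<in>D. ell2_normsq_ext UNIV (\<lambda>i. v i - w i) \<le> ennreal d"
    and fin: "a < \<infinity>" "b < \<infinity>"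
    and lower: "\<And>w. w \<in> D \<Longrightarrow> a * ell2_normsq_ext UNIV w \<le> ell2_normsq_ext L (T w)"
    and upper: "\<And>w. w \<in> D \<Longrightarrow> ell2_normsq_ext L (T w) \<le> b * ell2_normsq_ext UNIV w"
    and v: "v \<in> ell2 UNIV"
  shows "ell2_normsq_ext L (T v) \<le> b * ell2_normsq_ext UNIV v"
    and "a * ell2_normsq_ext UNIV v \<le> ell2_normsq_ext L (T v)"
proof -
  have lin: "T u l - T w l = T (\<lambda>i. u i - w i) l" if "u \<in> ell2 UNIV" "w \<in> ell2 UNIV" "l \<in> L" for u w l
    unfolding T using ell2_mult_summable[OF rows that(1)] ell2_mult_summable[OF rows that(2)] that(3)
    using infsum_add[of "\<lambda>i. M l i * u i" UNIV "\<lambda>i. - (M l i * w i)"] 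
    by (simp add: infsum_uminus summable_on_uminus right_diff_distrib)
  have lin': "ell2_normsq_ext F (\<lambda>l. T u l - T w l) = ell2_normsq_ext F (T (\<lambda>i. u i - w i))"
    if "u \<in> ell2 UNIV" "w \<in> ell2 UNIV" "F \<subseteq> L" for u w F
    unfolding ell2_normsq_ext_def using lin that by (intro infsum_cong) auto
  have mono: "ell2_normsq_ext F u \<le> ell2_normsq_ext L u" if "F \<subseteq> L" for F and u :: "'l \<Rightarrow> complex"
    by (rule ell2_normsq_ext_le) (use that sum_le_ell2_normsq_ext in blast)
  have up: "ell2_normsq_ext L (T v) \<le> b * ell2_normsq_ext UNIV v" if v: "v \<in> ell2 UNIV" for v
  proof (rule ell2_normsq_ext_le)
    fix F assume F: "finite F" "F \<subseteq> L"
    \<comment> \<open>the squared Frobenius norm of the rows in \<open>F\<close>\<close>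
    define K where "K = (\<Sum>l\<in>F. ell2_normsq_ext UNIV (M l))"
    have K: "K < \<infinity>" unfolding K_def using F rows by (auto simp: ell2_iff)
    have TF: "ell2_normsq_ext F (T u) \<le> K * ell2_normsq_ext UNIV u" for u
    proof -
      have "ell2_normsq_ext F (T u) = (\<Sum>l\<in>F. ennreal ((cmod (T u l))\<^sup>2))"
        unfolding ell2_normsq_ext_def using F by simp
      also have "\<dots> \<le> (\<Sum>l\<in>F. ell2_normsq_ext UNIV (M l) * ell2_normsq_ext UNIV u)"
        unfolding T by (intro sum_mono Cauchy_Schwarz_infsum cnt)
      finally show ?thesis unfolding K_def by (simp add: sum_distrib_right)
    qed
    have "ell2_normsq_ext F (T v) \<le> b * ell2_normsq_ext UNIV v"
    proof (rule ennreal_le_mult_eps, rule ennreal_le_mult_eps)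
      fix e e' :: real assume e: "e > 0" "e' > 0"
      let ?c = "ennreal (1 + e') * b * ennreal (1 + 1 / e) + ennreal (1 + 1 / e') * K"
      show "ell2_normsq_ext F (T v) \<le> ennreal (1 + e') * (ennreal (1 + e) * (b * ell2_normsq_ext UNIV v))"
      proof (rule ennreal_le_add_small[of ?c])
        show "?c < \<infinity>" using K fin by (auto simp: ennreal_mult_less_top)
        fix d :: real assume d: "d > 0"
        obtain w where w: "w \<in> D" "ell2_normsq_ext UNIV (\<lambda>i. v i - w i) \<le> ennreal d"
          using dense[OF v d] by blast
        have wl: "w \<in> ell2 UNIV" using w D by auto
        have w': "ell2_normsq_ext UNIV (\<lambda>i. w i - v i) \<le> ennreal d"
          using w(2) by (subst ell2_normsq_ext_minus_commute)
        have "ell2_normsq_ext F (T v) \<le> ennreal (1 + e') * ell2_normsq_ext F (T w) + ennreal (1 + 1 / e') * ell2_normsq_ext F (T (\<lambda>i. v i - w i))"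
          using ell2_normsq_ext_le_eps[OF e(2) countable_finite[OF F(1)], of "T v" "T w"] lin'[OF v wl F(2)] by simp
        also have "\<dots> \<le> ennreal (1 + e') * (b * ell2_normsq_ext UNIV w) + ennreal (1 + 1 / e') * (K * ennreal d)"
          by (intro add_mono mult_left_mono order_trans[OF mono[OF F(2)] upper[OF w(1)]]
                order_trans[OF TF] w(2)) auto
        also have "\<dots> \<le> ennreal (1 + e') * (b * (ennreal (1 + e) * ell2_normsq_ext UNIV v + ennreal (1 + 1 / e) * ennreal d)) + ennreal (1 + 1 / e') * (K * ennreal d)"
          by (intro add_right_mono mult_left_mono order_trans[OF ell2_normsq_ext_le_eps[OF e(1) cnt(2), of w v]]
                add_left_mono w') auto
        also have "\<dots> = ennreal (1 + e') * (ennreal (1 + e) * (b * ell2_normsq_ext UNIV v)) + ?c * ennreal d"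
          by (simp add: distrib_left distrib_right mult_ac add_ac)
        finally show "ell2_normsq_ext F (T v) \<le> ennreal (1 + e') * (ennreal (1 + e) * (b * ell2_normsq_ext UNIV v)) + ?c * ennreal d" .
      qed
    qed
    then show "ennreal (\<Sum>l\<in>F. (cmod (T v l))\<^sup>2) \<le> b * ell2_normsq_ext UNIV v"
      using sum_le_ell2_normsq_ext[OF F(1) order_refl, of "T v"] by (rule order_trans[rotated])
  qed
  show "ell2_normsq_ext L (T v) \<le> b * ell2_normsq_ext UNIV v" by (rule up[OF v])
  show "a * ell2_normsq_ext UNIV v \<le> ell2_normsq_ext L (T v)"
  proof (rule ennreal_le_mult_eps, rule ennreal_le_mult_eps)
    fix e e' :: real assume e: "e > 0" "e' > 0"
    let ?c = "ennreal (1 + e') * (ennreal (1 + 1 / e) * b) + a * ennreal (1 + 1 / e')"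
    show "a * ell2_normsq_ext UNIV v \<le> ennreal (1 + e') * (ennreal (1 + e) * ell2_normsq_ext L (T v))"
    proof (rule ennreal_le_add_small[of ?c])
      show "?c < \<infinity>" using fin by (auto simp: ennreal_mult_less_top)
      fix d :: real assume d: "d > 0"
      obtain w where w: "w \<in> D" "ell2_normsq_ext UNIV (\<lambda>i. v i - w i) \<le> ennreal d"
        using dense[OF v d] by blast
      have wl: "w \<in> ell2 UNIV" using w D by auto
      have w': "ell2_normsq_ext UNIV (\<lambda>i. w i - v i) \<le> ennreal d"
        using w(2) by (subst ell2_normsq_ext_minus_commute)
      have "a * ell2_normsq_ext UNIV v \<le> a * (ennreal (1 + e') * ell2_normsq_ext UNIV w + ennreal (1 + 1 / e') * ennreal d)"
        by (intro mult_left_mono order_trans[OF ell2_normsq_ext_le_eps[OF e(2) cnt(2), of v w]] add_left_mono w(2)) auto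
      also have "\<dots> = ennreal (1 + e') * (a * ell2_normsq_ext UNIV w) + a * ennreal (1 + 1 / e') * ennreal d"
        by (simp add: distrib_left mult_ac)
      also have "\<dots> \<le> ennreal (1 + e') * (ennreal (1 + e) * ell2_normsq_ext L (T v) + ennreal (1 + 1 / e) * (b * ennreal d)) + a * ennreal (1 + 1 / e') * ennreal d"
      proof (intro add_right_mono mult_left_mono order_trans[OF lower[OF w(1)]])
        have "ell2_normsq_ext L (T w) \<le> ennreal (1 + e) * ell2_normsq_ext L (T v) + ennreal (1 + 1 / e) * ell2_normsq_ext L (T (\<lambda>i. w i - v i))"
          using ell2_normsq_ext_le_eps[OF e(1) cnt(1), of "T w" "T v"] lin'[OF wl v order_refl] by simp
        also have "\<dots> \<le> ennreal (1 + e) * ell2_normsq_ext L (T v) + ennreal (1 + 1 / e) * (b * ennreal d)"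
          by (intro add_left_mono mult_left_mono order_trans[OF up[OF ell2_diff[OF cnt(2) wl v]]] w') auto
        finally show "ell2_normsq_ext L (T w) \<le> ennreal (1 + e) * ell2_normsq_ext L (T v) + ennreal (1 + 1 / e) * (b * ennreal d)" .
      qed auto
      also have "\<dots> = ennreal (1 + e') * (ennreal (1 + e) * ell2_normsq_ext L (T v)) + ?c * ennreal d"
        by (simp add: distrib_left distrib_right mult_ac add_ac)
      finally show "a * ell2_normsq_ext UNIV v \<le> ennreal (1 + e') * (ennreal (1 + e) * ell2_normsq_ext L (T v)) + ?c * ennreal d" .
    qed
  qed
qed

text \<open>Countability matters: an inequality that holds almost everywhere for each single vector then holds
  almost everywhere for all vectors of the dense set at once.\<close>

lemma countable_dense_finite_sequences:
  "\<exists>D :: ('i::countable \<Rightarrow> complex) set. countable D \<and> (\<forall>w\<in>D. finite {n. w n \<noteq> 0}) \<and>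
    (\<forall>v\<in>ell2 UNIV. \<forall>d>0. \<exists>w\<in>D. ell2_normsq_ext UNIV (\<lambda>i. v i - w i) \<le> ennreal d)"
proof -
  obtain Q :: "complex set" where Q: "countable Q" "\<And>X. open X \<Longrightarrow> X \<noteq> {} \<Longrightarrow> \<exists>q\<in>Q. q \<in> X"
    using countable_dense_exists by blast
  define ext :: "'i set \<Rightarrow> ('i \<Rightarrow> complex) \<Rightarrow> 'i \<Rightarrow> complex" where "ext F q = (\<lambda>n. if n \<in> F then q n else 0)" for F q
  define D where "D = (\<Union>F\<in>{F. finite F}. ext F ` (PiE F (\<lambda>_. Q)))"
  show ?thesis
  proof (intro exI[of _ D] conjI ballI allI impI)
    have "countable {F :: 'i set. finite F}"
      using countable_Collect_finite_subset[of "UNIV :: 'i set"] by simp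
    then show "countable D"
      unfolding D_def using Q(1) by (intro countable_UN countable_image countable_PiE) auto
    show "finite {n. w n \<noteq> 0}" if "w \<in> D" for w
      using that by (auto simp: D_def ext_def elim: rev_finite_subset)
    fix v :: "'i \<Rightarrow> complex" and d :: real assume v: "v \<in> ell2 UNIV" and d: "d > 0"
    define S where "S = (\<Sum>\<^sub>\<infinity>i. (cmod (v i))\<^sup>2)"
    have "(\<lambda>i. (cmod (v i))\<^sup>2) summable_on UNIV" using v by (simp add: ell2_def)
    then have hs: "((\<lambda>i. (cmod (v i))\<^sup>2) has_sum S) UNIV" unfolding S_def by (rule has_sum_infsum)
    have le: "(\<Sum>i\<in>G. (cmod (v i))\<^sup>2) \<le> S" if "finite G" for G
      unfolding S_def by (rule finite_sum_le_infsum[OF has_sum_imp_summable[OF hs] that]) auto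
    have "eventually (\<lambda>F. (\<Sum>i\<in>F. (cmod (v i))\<^sup>2) > S - d / 2) (finite_subsets_at_top UNIV)"
      using hs d unfolding has_sum_def by (intro order_tendstoD(1)) auto
    then obtain F where F: "finite F" "(\<Sum>i\<in>F. (cmod (v i))\<^sup>2) > S - d / 2"
      unfolding eventually_finite_subsets_at_top by auto
    \<comment> \<open>\<open>d / 2\<close> is the budget for the entries in \<open>F\<close>; the \<open>+ 1\<close> covers the case of empty \<open>F\<close>\<close>
    define r where "r = sqrt (d / (2 * (real (card F) + 1)))"
    have r: "r > 0" "r\<^sup>2 = d / (2 * (real (card F) + 1))" using d by (auto simp: r_def)
    have "\<exists>q\<in>Q. q \<in> ball (v i) r" for i using r by (intro Q(2)) auto
    then have "\<forall>i. \<exists>q. q \<in> Q \<and> cmod (v i - q) < r" by (simp add: dist_norm Bex_def)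
    from choice[OF this] obtain q where "\<forall>i. q i \<in> Q \<and> cmod (v i - q i) < r" ..
    then have q: "q i \<in> Q" "cmod (v i - q i) < r" for i by simp_all
    have split: "sum u (F \<union> G) = sum u F + sum u (G - F)" if "finite G" for u :: "'i \<Rightarrow> real" and G
      using sum.subset_diff[of F "F \<union> G" u] F(1) that by (simp add: Un_Diff)
    define w where "w = ext F (restrict q F)"
    have "restrict q F \<in> PiE F (\<lambda>_. Q)" by (rule restrict_PiE_iff[THEN iffD2]) (simp add: q)
    then have w: "w \<in> D" unfolding D_def w_def using F(1) by (intro UN_I[of F] imageI CollectI)
    have "ell2_normsq_ext UNIV (\<lambda>i. v i - w i) \<le> ennreal d"
    proof (rule ell2_normsq_ext_le, rule ennreal_leI)
      fix G :: "'i set" assume G: "finite G"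
      have "(\<Sum>i\<in>G. (cmod (v i - w i))\<^sup>2) \<le> (\<Sum>i\<in>F \<union> G. (cmod (v i - w i))\<^sup>2)"
        using F G by (intro sum_mono2) auto
      also have "\<dots> = (\<Sum>i\<in>F. (cmod (v i - w i))\<^sup>2) + (\<Sum>i\<in>G - F. (cmod (v i - w i))\<^sup>2)"
        by (rule split[OF G])
      also have "(\<Sum>i\<in>F. (cmod (v i - w i))\<^sup>2) \<le> (\<Sum>i\<in>F. r\<^sup>2)"
        by (intro sum_mono power_mono) (use q(2) in \<open>auto simp: w_def ext_def less_imp_le\<close>)
      also have "\<dots> \<le> d / 2" using d by (simp add: r field_simps)
      also have "(\<Sum>i\<in>G - F. (cmod (v i - w i))\<^sup>2) = (\<Sum>i\<in>G - F. (cmod (v i))\<^sup>2)"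
        by (intro sum.cong) (auto simp: w_def ext_def)
      also have "\<dots> = (\<Sum>i\<in>F \<union> G. (cmod (v i))\<^sup>2) - (\<Sum>i\<in>F. (cmod (v i))\<^sup>2)"
        by (simp add: split[OF G])
      also have "\<dots> \<le> d / 2" using le[of "F \<union> G"] F G by simp
      finally show "(\<Sum>i\<in>G. (cmod (v i - w i))\<^sup>2) \<le> d" by simp
    qed
    with w show "\<exists>w\<in>D. ell2_normsq_ext UNIV (\<lambda>i. v i - w i) \<le> ennreal d" by blast
  qed
qed

section \<open>From frame bounds to matrix bounds\<close>

text \<open>Test the assumption on the set where the inequality fails. On it the integral of \<open>g\<close> is finite, so a
  positive measure would make the integral of \<open>f\<close> strictly larger.\<close>

lemma AE_le_if_set_integrals_le:
  fixes f g :: "'a \<Rightarrow> ennreal"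
  assumes [measurable]: "f \<in> borel_measurable M" "g \<in> borel_measurable M"
    and fin: "(\<integral>\<^sup>+x. f x \<partial>M) < \<infinity> \<or> (\<integral>\<^sup>+x. g x \<partial>M) < \<infinity>"
    and le: "\<And>E. E \<in> sets M \<Longrightarrow> (\<integral>\<^sup>+x. indicator E x * f x \<partial>M) \<le> (\<integral>\<^sup>+x. indicator E x * g x \<partial>M)"
  shows "AE x in M. f x \<le> g x"
proof (rule ccontr)
  assume neg: "\<not> (AE x in M. f x \<le> g x)"
  define E where "E = {x \<in> space M. g x < f x}"
  have E [measurable]: "E \<in> sets M" unfolding E_def by measurable
  have "(\<integral>\<^sup>+x. indicator E x * g x \<partial>M) < (\<integral>\<^sup>+x. indicator E x * f x \<partial>M)"
  proof (rule nn_integral_less)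
    have "(\<integral>\<^sup>+x. indicator E x * g x \<partial>M) \<le> (\<integral>\<^sup>+x. f x \<partial>M)"
      by (rule nn_integral_mono) (simp add: E_def indicator_def less_imp_le)
    moreover have "(\<integral>\<^sup>+x. indicator E x * g x \<partial>M) \<le> (\<integral>\<^sup>+x. g x \<partial>M)"
      by (rule nn_integral_mono) (simp add: indicator_def)
    ultimately show "(\<integral>\<^sup>+x. indicator E x * g x \<partial>M) \<noteq> \<infinity>" using fin by (auto simp: top_unique)
    show "AE x in M. indicator E x * g x \<le> indicator E x * f x"
      by (intro AE_I2) (auto simp: E_def indicator_def)
    show "\<not> (AE x in M. indicator E x * f x \<le> indicator E x * g x)"
    proof
      assume "AE x in M. indicator E x * f x \<le> indicator E x * g x"
      then have "AE x in M. f x \<le> g x"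
        using AE_space
      proof eventually_elim
        case (elim x)
        then show ?case by (cases "x \<in> E") (auto simp: E_def not_less)
      qed
      with neg show False ..
    qed
  qed simp_all
  with le[OF E] show False by simp
qed

text \<open>The function that over the points of \<open>E\<close> has fiber \<open>v\<close>, and over the rest of the period fiber \<open>0\<close>:
  \<open>\<lfloor>\<beta> * x\<rfloor>\<close> is the number of the period containing \<open>x\<close>, and \<open>E\<close> serves to localize the frame inequalities.\<close>

definition step_function :: "real \<Rightarrow> (int \<Rightarrow> complex) \<Rightarrow> real set \<Rightarrow> real \<Rightarrow> complex" where
  "step_function \<beta> v E x = cnj (v \<lfloor>\<beta> * x\<rfloor>) * indicator E (x - of_int \<lfloor>\<beta> * x\<rfloor> / \<beta>)"

lemma fiber_step_function:
  assumes "\<beta> > 0" "x \<in> {0..<1/\<beta>}"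
  shows "fiber \<beta> (step_function \<beta> v E) x = (\<lambda>n. indicator E x * v n)"
proof
  fix n
  have "\<lfloor>\<beta> * (x + of_int n / \<beta>)\<rfloor> = n" using assms(2) cell_floor[OF assms(1)] by blast
  then show "fiber \<beta> (step_function \<beta> v E) x n = indicator E x * v n"
    by (simp add: fiber_def step_function_def indicator_def)
qed

lemma step_function_measurable:
  assumes "E \<in> sets lebesgue" shows "step_function \<beta> v E \<in> borel_measurable lebesgue"
  unfolding step_function_def[abs_def]
proof (rule measurable_compose_countable)
  show "(\<lambda>x. \<lfloor>\<beta> * x\<rfloor>) \<in> measurable lebesgue (count_space UNIV)"
    by (intro measurable_completion) simp
  fix n :: int
  have "(\<lambda>x. indicator E (x + (- of_int n / \<beta>)) :: complex) \<in> borel_measurable lebesgue"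
    by (rule measurable_translate) (use assms in simp)
  then show "(\<lambda>x. cnj (v n) * indicator E (x - of_int n / \<beta>)) \<in> borel_measurable lebesgue"
    by simp
qed

lemma ell2_normsq_ext_indicator:
  "ell2_normsq_ext I (\<lambda>i. indicator E x * v i) = indicator E x * ell2_normsq_ext I v"
  by (simp add: ell2_normsq_ext_def indicator_def)

lemma step_function_norm:
  assumes "\<beta> > 0" "v \<in> ell2 UNIV" "E \<in> sets lebesgue"
  shows "step_function \<beta> v E \<in> L2"
    and "ennreal ((L2_norm (step_function \<beta> v E))\<^sup>2) = (\<integral>\<^sup>+x. indicator E x * ell2_normsq_ext UNIV v \<partial>cell \<beta>)"
proof -
  let ?h = "step_function \<beta> v E"
  note [measurable] = step_function_measurable[OF assms(3)] assms(3)
  have "(\<integral>\<^sup>+x. ennreal ((cmod (?h x))\<^sup>2) \<partial>lebesgue) = (\<integral>\<^sup>+x. ell2_normsq_ext UNIV (fiber \<beta> ?h x) \<partial>cell \<beta>)"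
    unfolding ell2_normsq_ext_eq_nn_integral[OF countableI_type] fiber_def
    by (simp add: nn_integral_tiling[OF assms(1), of "\<lambda>x. ennreal ((cmod (?h x))\<^sup>2)"])
  also have "\<dots> = (\<integral>\<^sup>+x. indicator E x * ell2_normsq_ext UNIV v \<partial>cell \<beta>)"
    by (intro nn_integral_cong)
       (simp add: space_restrict_space fiber_step_function[OF assms(1)] ell2_normsq_ext_indicator)
  finally have eq: "(\<integral>\<^sup>+x. ennreal ((cmod (?h x))\<^sup>2) \<partial>lebesgue) = (\<integral>\<^sup>+x. indicator E x * ell2_normsq_ext UNIV v \<partial>cell \<beta>)" .
  have "(\<integral>\<^sup>+x. indicator E x * ell2_normsq_ext UNIV v \<partial>cell \<beta>) \<le> (\<integral>\<^sup>+x. ell2_normsq_ext UNIV v \<partial>cell \<beta>)"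
    by (intro nn_integral_mono) (simp add: indicator_def)
  also have "\<dots> < \<infinity>"
    using assms(1,2) by (simp add: emeasure_restrict_space space_restrict_space ell2_iff ennreal_mult_less_top)
  finally have "integrable lebesgue (\<lambda>x. (cmod (?h x))\<^sup>2)"
    by (intro integrableI_bounded) (simp_all add: eq)
  then show L2: "?h \<in> L2" by (simp add: L2_def)
  show "ennreal ((L2_norm ?h)\<^sup>2) = (\<integral>\<^sup>+x. indicator E x * ell2_normsq_ext UNIV v \<partial>cell \<beta>)"
    unfolding L2_norm_eq_nn_integral[OF L2] by (rule eq)
qed

lemma L2_zero: "(\<lambda>_. 0) \<in> L2"
  by (simp add: L2_def)

lemma L2_add:
  assumes "f \<in> L2" "g \<in> L2" shows "(\<lambda>x. f x + g x) \<in> L2"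
proof -
  note [measurable] = L2D(1)[OF assms(1)] L2D(1)[OF assms(2)]
  have "integrable lebesgue (\<lambda>x. (cmod (f x + g x))\<^sup>2)"
  proof (rule Bochner_Integration.integrable_bound)
    show "integrable lebesgue (\<lambda>x. (1 + 1) * (cmod (f x))\<^sup>2 + (1 + 1 / 1) * (cmod (g x))\<^sup>2)"
      using L2D(2)[OF assms(1)] L2D(2)[OF assms(2)] by simp
    show "AE x in lebesgue. norm ((cmod (f x + g x))\<^sup>2) \<le> norm ((1 + 1) * (cmod (f x))\<^sup>2 + (1 + 1 / 1) * (cmod (g x))\<^sup>2)"
    proof (rule AE_I2)
      fix x show "norm ((cmod (f x + g x))\<^sup>2) \<le> norm ((1 + 1) * (cmod (f x))\<^sup>2 + (1 + 1 / 1) * (cmod (g x))\<^sup>2)"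
        using cmod_square_le_eps[of 1 "f x + g x" "f x"] by simp
    qed
  qed simp
  then show ?thesis by (simp add: L2_def)
qed

lemma L2_mult_bounded:
  assumes "f \<in> L2" "a \<in> borel_measurable lebesgue" "\<And>x. cmod (a x) \<le> C"
  shows "(\<lambda>x. a x * f x) \<in> L2"
proof -
  note [measurable] = L2D(1)[OF assms(1)] assms(2)
  have "integrable lebesgue (\<lambda>x. (cmod (a x * f x))\<^sup>2)"
  proof (rule Bochner_Integration.integrable_bound)
    show "integrable lebesgue (\<lambda>x. C\<^sup>2 * (cmod (f x))\<^sup>2)" using L2D(2)[OF assms(1)] by simp
    show "AE x in lebesgue. norm ((cmod (a x * f x))\<^sup>2) \<le> norm (C\<^sup>2 * (cmod (f x))\<^sup>2)"
      using assms(3) by (simp add: norm_mult power_mult_distrib mult_right_mono power_mono)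
  qed simp
  then show ?thesis by (simp add: L2_def)
qed

lemma L2_sum:
  assumes "finite S" "\<And>n. n \<in> S \<Longrightarrow> f n \<in> L2" shows "(\<lambda>x. \<Sum>n\<in>S. f n x) \<in> L2"
  using assms by (induction S rule: finite_induct) (auto intro: L2_zero L2_add)

lemma gabor_matrix_apply_finite:
  assumes "finite {n. w n \<noteq> 0}"
  shows "gabor_matrix_apply \<beta> g c x w l = (\<Sum>n | w n \<noteq> 0. gabor_matrix \<beta> g c x l n * w n)"
proof -
  have "gabor_matrix_apply \<beta> g c x w l = (\<Sum>\<^sub>\<infinity>n\<in>{n. w n \<noteq> 0}. gabor_matrix \<beta> g c x l n * w n)"
    unfolding gabor_matrix_apply_def by (rule infsum_cong_neutral) auto
  then show ?thesis using assms by simp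
qed

lemma gabor_matrix_apply_finite_L2:
  assumes "g \<in> L2" "finite {n. w n \<noteq> 0}"
  shows "(\<lambda>x. gabor_matrix_apply \<beta> g c x w l) \<in> L2"
  unfolding gabor_matrix_apply_finite[OF assms(2)]
proof (rule L2_sum[OF assms(2)])
  fix n
  have "(\<lambda>x. (cis (2 * pi * c l * (of_int n / \<beta>)) * w n) * g (x + (of_int n / \<beta> - l))) \<in> L2"
    by (rule L2_mult_bounded[OF L2_translate[OF assms(1)]]) auto
  then show "(\<lambda>x. gabor_matrix \<beta> g c x l n * w n) \<in> L2"
    by (simp add: gabor_matrix_def mult_ac add_diff_eq)
qed

lemma finite_support_ell2:
  assumes "finite {n. w n \<noteq> 0}" shows "w \<in> ell2 UNIV"
proof -
  have "(\<lambda>n. (cmod (w n))\<^sup>2) summable_on {n. w n \<noteq> 0}" using assms by simp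
  moreover have "(\<lambda>n. (cmod (w n))\<^sup>2) summable_on {n. w n \<noteq> 0} \<longleftrightarrow> (\<lambda>n. (cmod (w n))\<^sup>2) summable_on UNIV"
    by (rule summable_on_cong_neutral) auto
  ultimately show ?thesis by (simp add: ell2_def)
qed

lemma gabor_matrix_apply_indicator:
  "gabor_matrix_apply \<beta> g c x (\<lambda>n. indicator E x * w n) l = indicator E x * gabor_matrix_apply \<beta> g c x w l"
  by (simp add: gabor_matrix_apply_def indicator_def)

text \<open>For finitely supported \<open>w\<close> each row is a finite combination of translates of \<open>g\<close>, hence square
  integrable without any assumption on the matrices.\<close>

lemma step_function_coefficients:
  assumes "\<beta> > 0" "g \<in> L2" "countable \<Lambda>" and w: "finite {n. w n \<noteq> 0}" and E: "E \<in> sets lebesgue"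
  shows "(\<integral>\<^sup>+x. indicator E x * ell2_normsq_ext \<Lambda> (gabor_matrix_apply \<beta> g c x w) \<partial>cell \<beta>) =
    ennreal \<beta> * ell2_normsq_ext (semi_regular_set \<beta> \<Lambda> c) (gabor_coeff g (step_function \<beta> w E))"
proof -
  let ?h = "step_function \<beta> w E"
  have G: "gabor_matrix_apply \<beta> g c x (fiber \<beta> ?h x) = (\<lambda>l. indicator E x * gabor_matrix_apply \<beta> g c x w l)"
    if "x \<in> space (cell \<beta>)" for x
    using that by (intro ext) (simp add: space_restrict_space fiber_step_function[OF assms(1)] gabor_matrix_apply_indicator)
  have int: "integrable (cell \<beta>) (\<lambda>x. (cmod (gabor_matrix_apply \<beta> g c x (fiber \<beta> ?h x) l))\<^sup>2)" for l
  proof -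
    have "(\<lambda>x. indicator E x * gabor_matrix_apply \<beta> g c x w l) \<in> L2"
      by (rule L2_mult_bounded[OF gabor_matrix_apply_finite_L2[OF assms(2) w], where C = 1])
         (use E in \<open>auto simp: indicator_def\<close>)
    then have "integrable (cell \<beta>) (\<lambda>x. (cmod (indicator E x * gabor_matrix_apply \<beta> g c x w l))\<^sup>2)"
      using integrable_mult_indicator[OF _ L2D(2), of "{0..<1/\<beta>}"] by (subst integrable_restrict_space) auto
    then show ?thesis by (subst Bochner_Integration.integrable_cong[OF refl]) (auto simp: G)
  qed
  have "(\<integral>\<^sup>+x. indicator E x * ell2_normsq_ext \<Lambda> (gabor_matrix_apply \<beta> g c x w) \<partial>cell \<beta>) =
    (\<integral>\<^sup>+x. ell2_normsq_ext \<Lambda> (gabor_matrix_apply \<beta> g c x (fiber \<beta> ?h x)) \<partial>cell \<beta>)"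
    by (intro nn_integral_cong) (simp add: G ell2_normsq_ext_indicator)
  also have "\<dots> = ennreal \<beta> * ell2_normsq_ext (semi_regular_set \<beta> \<Lambda> c) (gabor_coeff g ?h)"
    by (rule fiber_identity[OF assms(1,2) step_function_norm(1)[OF assms(1) finite_support_ell2[OF w] E] assms(3) int])
  finally show ?thesis .
qed

text \<open>The frame inequalities for the step functions of \<open>w\<close> compare the integrals over every measurable
  subset of the period, hence the integrands.\<close>

lemma frame_bounds_imp_matrix_bounds_finite:
  assumes "\<beta> > 0" "g \<in> L2" "countable \<Lambda>" and w: "finite {n. w n \<noteq> 0}" and "A \<ge> 0" "B \<ge> 0"
    and lower: "\<And>h. h \<in> L2 \<Longrightarrow> ennreal (A * (L2_norm h)\<^sup>2) \<le> ell2_normsq_ext (semi_regular_set \<beta> \<Lambda> c) (gabor_coeff g h)"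
    and upper: "\<And>h. h \<in> L2 \<Longrightarrow> ell2_normsq_ext (semi_regular_set \<beta> \<Lambda> c) (gabor_coeff g h) \<le> ennreal (B * (L2_norm h)\<^sup>2)"
  shows "AE x in cell \<beta>. ennreal (A * \<beta>) * ell2_normsq_ext UNIV w \<le> ell2_normsq_ext \<Lambda> (gabor_matrix_apply \<beta> g c x w) \<and>
    ell2_normsq_ext \<Lambda> (gabor_matrix_apply \<beta> g c x w) \<le> ennreal (B * \<beta>) * ell2_normsq_ext UNIV w"
proof -
  let ?\<Phi> = "\<lambda>x. ell2_normsq_ext \<Lambda> (gabor_matrix_apply \<beta> g c x w)"
  note wl = finite_support_ell2[OF w]
  have m [measurable]: "?\<Phi> \<in> borel_measurable (cell \<beta>)"
    by (intro ell2_normsq_ext_measurable assms(3) measurable_restrict_space1 L2D(1) gabor_matrix_apply_finite_L2 assms(2) w)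
  have fin: "(\<integral>\<^sup>+x. ennreal C * ell2_normsq_ext UNIV w \<partial>cell \<beta>) < \<infinity>" for C
    using wl assms(1) by (simp add: emeasure_restrict_space space_restrict_space ell2_iff ennreal_mult_less_top)
  have scale: "(\<integral>\<^sup>+x. indicator E x * (ennreal (C * \<beta>) * ell2_normsq_ext UNIV w) \<partial>cell \<beta>) =
      ennreal \<beta> * ennreal (C * (L2_norm (step_function \<beta> w E))\<^sup>2)"
    if "C \<ge> 0" "E \<in> sets (cell \<beta>)" "E \<in> sets lebesgue" for C E
  proof -
    have "(\<integral>\<^sup>+x. indicator E x * (ennreal (C * \<beta>) * ell2_normsq_ext UNIV w) \<partial>cell \<beta>) =
      (\<integral>\<^sup>+x. ennreal (C * \<beta>) * (indicator E x * ell2_normsq_ext UNIV w) \<partial>cell \<beta>)"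
      by (simp add: mult_ac)
    also have "\<dots> = ennreal (C * \<beta>) * (\<integral>\<^sup>+x. indicator E x * ell2_normsq_ext UNIV w \<partial>cell \<beta>)"
      using that(2) by (intro nn_integral_cmult borel_measurable_times_ennreal borel_measurable_indicator measurable_const) simp_all
    also have "\<dots> = ennreal (C * \<beta>) * ennreal ((L2_norm (step_function \<beta> w E))\<^sup>2)"
      by (simp only: step_function_norm(2)[OF assms(1) wl that(3)])
    also have "\<dots> = ennreal \<beta> * ennreal (C * (L2_norm (step_function \<beta> w E))\<^sup>2)"
      using assms(1) that(1) by (simp add: mult_ac flip: ennreal_mult')
    finally show ?thesis .
  qed
  have sets: "E \<in> sets lebesgue" if "E \<in> sets (cell \<beta>)" for E
    using that by (simp add: sets_restrict_space_iff)
  have "AE x in cell \<beta>. ennreal (A * \<beta>) * ell2_normsq_ext UNIV w \<le> ?\<Phi> x"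
  proof (rule AE_le_if_set_integrals_le)
    fix E assume E: "E \<in> sets (cell \<beta>)"
    show "(\<integral>\<^sup>+x. indicator E x * (ennreal (A * \<beta>) * ell2_normsq_ext UNIV w) \<partial>cell \<beta>) \<le> (\<integral>\<^sup>+x. indicator E x * ?\<Phi> x \<partial>cell \<beta>)"
      unfolding scale[OF \<open>A \<ge> 0\<close> E sets[OF E]] step_function_coefficients[OF assms(1-3) w sets[OF E]]
      by (intro mult_left_mono lower step_function_norm(1)[OF assms(1) wl sets[OF E]]) simp
  qed (use fin m in auto)
  moreover have "AE x in cell \<beta>. ?\<Phi> x \<le> ennreal (B * \<beta>) * ell2_normsq_ext UNIV w"
  proof (rule AE_le_if_set_integrals_le)
    fix E assume E: "E \<in> sets (cell \<beta>)"
    show "(\<integral>\<^sup>+x. indicator E x * ?\<Phi> x \<partial>cell \<beta>) \<le> (\<integral>\<^sup>+x. indicator E x * (ennreal (B * \<beta>) * ell2_normsq_ext UNIV w) \<partial>cell \<beta>)"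
      unfolding scale[OF \<open>B \<ge> 0\<close> E sets[OF E]] step_function_coefficients[OF assms(1-3) w sets[OF E]]
      by (intro mult_left_mono upper step_function_norm(1)[OF assms(1) wl sets[OF E]]) simp
  qed (use fin m in auto)
  ultimately show ?thesis by eventually_elim simp
qed

lemma AE_gabor_matrix_rows_ell2:
  assumes "\<beta> > 0" "g \<in> L2" "countable \<Lambda>"
  shows "AE x in cell \<beta>. \<forall>l\<in>\<Lambda>. gabor_matrix \<beta> g c x l \<in> ell2 UNIV"
proof (rule AE_ball_countable'[OF _ assms(3)])
  fix l
  have "AE x in cell \<beta>. fiber \<beta> (\<lambda>x. g (x + - l)) x \<in> ell2 UNIV"
    by (rule AE_fiber_ell2[OF assms(1) L2_translate[OF assms(2)]])
  then show "AE x in cell \<beta>. gabor_matrix \<beta> g c x l \<in> ell2 UNIV"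
    by (simp add: ell2_def gabor_matrix_def fiber_def norm_mult)
qed

text \<open>Moving \<open>x\<close> by one period shifts the columns and multiplies the rows by unimodular constants, so the
  bounds are periodic in \<open>x\<close>.\<close>

lemma gabor_matrix_apply_shift:
  assumes "\<beta> > 0"
  shows "gabor_matrix_apply \<beta> g c (x + of_int m / \<beta>) v l =
    cis (- (2 * pi * c l * (of_int m / \<beta>))) * gabor_matrix_apply \<beta> g c x (\<lambda>n. v (n - m)) l"
proof -
  have "gabor_matrix_apply \<beta> g c x (\<lambda>n. v (n - m)) l = (\<Sum>\<^sub>\<infinity>n. gabor_matrix \<beta> g c x l (n + m) * v n)"
    unfolding gabor_matrix_apply_def
    using infsum_reindex_bij_betw[of "\<lambda>n. n + m" UNIV UNIV "\<lambda>n. gabor_matrix \<beta> g c x l n * v (n - m)"]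
    by (simp add: bij_plus_right)
  moreover have "gabor_matrix \<beta> g c (x + of_int m / \<beta>) l n =
      cis (- (2 * pi * c l * (of_int m / \<beta>))) * gabor_matrix \<beta> g c x l (n + m)" for n
  proof -
    have "cis (- (2 * pi * c l * (of_int m / \<beta>))) * cis (2 * pi * c l * (of_int (n + m) / \<beta>)) = cis (2 * pi * c l * (of_int n / \<beta>))"
      unfolding cis_mult by (intro arg_cong[where f = cis]) (simp add: add_divide_distrib ring_distribs)
    moreover have "x + of_int (n + m) / \<beta> - l = x + of_int m / \<beta> + of_int n / \<beta> - l"
      by (simp add: add_divide_distrib)
    ultimately show ?thesis unfolding gabor_matrix_def by (metis mult.left_commute)
  qed
  ultimately show ?thesis
    unfolding gabor_matrix_apply_def by (simp only: mult.assoc infsum_cmult_right')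
qed

text \<open>The exceptional set is covered by countably many translates of a null set.\<close>

lemma AE_lebesgue_of_AE_cell:
  assumes "\<beta> > 0" and cell: "AE x in cell \<beta>. P x"
    and shift: "\<And>x m. P x \<Longrightarrow> P (x + of_int m / \<beta>)"
  shows "AE x in lebesgue. P x"
proof -
  have "AE x in lebesgue. x \<in> {0..<1/\<beta>} \<longrightarrow> P x"
    using cell by (subst (asm) AE_restrict_space_iff) auto
  then obtain N where N: "N \<in> null_sets lebesgue" "{x. \<not> (x \<in> {0..<1/\<beta>} \<longrightarrow> P x)} \<subseteq> N"
    by (auto simp: eventually_ae_filter)
  have "negligible (\<Union>m::int. (\<lambda>x. of_int m / \<beta> + x) ` N)"
    using N(1) by (intro negligible_countable_Union) (auto simp: negligible_translation negligible_iff_null_sets[symmetric])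
  moreover have "{x. \<not> P x} \<subseteq> (\<Union>m::int. (\<lambda>x. of_int m / \<beta> + x) ` N)"
  proof
    fix x assume "x \<in> {x. \<not> P x}"
    define m where "m = \<lfloor>\<beta> * x\<rfloor>"
    define y where "y = x - of_int m / \<beta>"
    have xy: "x = y + of_int m / \<beta>" by (simp add: y_def)
    have "y \<in> {0..<1/\<beta>}" unfolding cell_floor[OF assms(1), of y m]
      by (subst xy[symmetric]) (rule m_def[symmetric])
    moreover have "\<not> P y" using shift[of y m] \<open>x \<in> {x. \<not> P x}\<close> xy by auto
    ultimately have "y \<in> N" using N(2) by auto
    then show "x \<in> (\<Union>m::int. (\<lambda>x. of_int m / \<beta> + x) ` N)" using xy by (auto simp: add.commute)
  qed
  ultimately show ?thesis
    by (intro AE_I'[of "\<Union>m::int. (\<lambda>x. of_int m / \<beta> + x) ` N"]) (auto simp: negligible_iff_null_sets)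
qed

theorem frame_bounds_imp_matrix_bounds:
  assumes "\<beta> > 0" "g \<in> L2" "countable \<Lambda>" "A \<ge> 0" "B \<ge> 0"
    and lower: "\<And>h. h \<in> L2 \<Longrightarrow> ennreal (A * (L2_norm h)\<^sup>2) \<le> ell2_normsq_ext (semi_regular_set \<beta> \<Lambda> c) (gabor_coeff g h)"
    and upper: "\<And>h. h \<in> L2 \<Longrightarrow> ell2_normsq_ext (semi_regular_set \<beta> \<Lambda> c) (gabor_coeff g h) \<le> ennreal (B * (L2_norm h)\<^sup>2)"
  shows "AE x in lebesgue. \<forall>v\<in>ell2 UNIV.
    ennreal (A * \<beta> * (ell2_norm UNIV v)\<^sup>2) \<le> ell2_normsq_ext \<Lambda> (gabor_matrix_apply \<beta> g c x v) \<and>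
    ell2_normsq_ext \<Lambda> (gabor_matrix_apply \<beta> g c x v) \<le> ennreal (B * \<beta> * (ell2_norm UNIV v)\<^sup>2)"
proof -
  let ?P = "\<lambda>x. \<forall>v\<in>ell2 UNIV.
    ennreal (A * \<beta>) * ell2_normsq_ext UNIV v \<le> ell2_normsq_ext \<Lambda> (gabor_matrix_apply \<beta> g c x v) \<and>
    ell2_normsq_ext \<Lambda> (gabor_matrix_apply \<beta> g c x v) \<le> ennreal (B * \<beta>) * ell2_normsq_ext UNIV v"
  obtain D :: "(int \<Rightarrow> complex) set" where D: "countable D" "\<And>w. w \<in> D \<Longrightarrow> finite {n. w n \<noteq> 0}"
    "\<And>v d. v \<in> ell2 UNIV \<Longrightarrow> d > 0 \<Longrightarrow> \<exists>w\<in>D. ell2_normsq_ext UNIV (\<lambda>i. v i - w i) \<le> ennreal d"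
    using countable_dense_finite_sequences[where 'i = int] by blast
  have "AE x in lebesgue. ?P x"
  proof (rule AE_lebesgue_of_AE_cell[OF assms(1)])
    have "AE x in cell \<beta>. \<forall>w\<in>D. ennreal (A * \<beta>) * ell2_normsq_ext UNIV w \<le> ell2_normsq_ext \<Lambda> (gabor_matrix_apply \<beta> g c x w) \<and>
      ell2_normsq_ext \<Lambda> (gabor_matrix_apply \<beta> g c x w) \<le> ennreal (B * \<beta>) * ell2_normsq_ext UNIV w"
      by (rule AE_ball_countable'[OF _ D(1)])
         (rule frame_bounds_imp_matrix_bounds_finite[OF assms(1-3) D(2) assms(4,5) lower upper])
    then show "AE x in cell \<beta>. ?P x"
      using AE_gabor_matrix_rows_ell2[OF assms(1-3), of c]
    proof eventually_elim
      case (elim x)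
      have Dl: "D \<subseteq> ell2 UNIV" using D(2) finite_support_ell2 by blast
      note ext = matrix_bounds_dense_extend[where M = "gabor_matrix \<beta> g c x" and D = D
          and T = "gabor_matrix_apply \<beta> g c x" and a = "ennreal (A * \<beta>)" and b = "ennreal (B * \<beta>)",
          OF gabor_matrix_apply_def assms(3) countableI_type _ Dl D(3)]
      have rows: "gabor_matrix \<beta> g c x l \<in> ell2 UNIV" if "l \<in> \<Lambda>" for l
        using elim(2) that by blast
      have lw: "ennreal (A * \<beta>) * ell2_normsq_ext UNIV w \<le> ell2_normsq_ext \<Lambda> (gabor_matrix_apply \<beta> g c x w)"
        and uw: "ell2_normsq_ext \<Lambda> (gabor_matrix_apply \<beta> g c x w) \<le> ennreal (B * \<beta>) * ell2_normsq_ext UNIV w"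
        if "w \<in> D" for w
        using elim(1) that by blast+
      show ?case
        using ext[OF rows _ _ _ _ lw uw] by simp
    qed
  next
    fix x and m :: int assume P: "?P x"
    show "?P (x + of_int m / \<beta>)"
    proof
      fix v :: "int \<Rightarrow> complex" assume v: "v \<in> ell2 UNIV"
      define v' where "v' = (\<lambda>n. v (n - m))"
      have n: "ell2_normsq_ext UNIV v' = ell2_normsq_ext UNIV v"
        unfolding ell2_normsq_ext_def v'_def
        by (rule infsum_reindex_bij_betw) (simp add: bij_diff_right)
      have "ell2_normsq_ext \<Lambda> (gabor_matrix_apply \<beta> g c (x + of_int m / \<beta>) v) = ell2_normsq_ext \<Lambda> (gabor_matrix_apply \<beta> g c x v')"
        unfolding ell2_normsq_ext_def gabor_matrix_apply_shift[OF assms(1)] v'_def by (simp add: norm_mult)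
      moreover have "v' \<in> ell2 UNIV" using v n by (simp add: ell2_iff)
      ultimately show "ennreal (A * \<beta>) * ell2_normsq_ext UNIV v \<le> ell2_normsq_ext \<Lambda> (gabor_matrix_apply \<beta> g c (x + of_int m / \<beta>) v) \<and>
        ell2_normsq_ext \<Lambda> (gabor_matrix_apply \<beta> g c (x + of_int m / \<beta>) v) \<le> ennreal (B * \<beta>) * ell2_normsq_ext UNIV v"
        using P n by (metis (no_types, lifting))
    qed
  qed
  then show ?thesis
    by eventually_elim (use assms(1,4,5) in \<open>simp add: ell2_normsq_ext_ell2 ennreal_mult'\<close>)
qed

section \<open>Optimal bounds\<close>

text \<open>Isolated points can be told apart by members of a countable base.\<close>

lemma discrete_imp_countable:
  fixes S :: "'a::second_countable_topology set"
  assumes "discrete S" shows "countable S"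
proof -
  obtain \<B> :: "'a set set" where \<B>: "countable \<B>" "topological_basis \<B>"
    using ex_countable_basis by blast
  have "\<exists>B\<in>\<B>. B \<inter> S = {x}" if "x \<in> S" for x
  proof -
    have "x isolated_in S" using assms that by (simp add: discrete_def)
    then obtain U where U: "open U" "U \<inter> S = {x}" by (rule isolated_inE)
    then have "x \<in> U" by blast
    from topological_basisE[OF \<B>(2) U(1) this] obtain B where "B \<in> \<B>" "x \<in> B" "B \<subseteq> U" .
    with U(2) that show ?thesis by blast
  qed
  then have "\<forall>x\<in>S. \<exists>B. B \<in> \<B> \<and> B \<inter> S = {x}" by blast
  from bchoice[OF this] obtain f where f: "\<forall>x\<in>S. f x \<in> \<B> \<and> f x \<inter> S = {x}" ..
  have "inj_on f S"
  proof (rule inj_onI)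
    fix x y assume xy: "x \<in> S" "y \<in> S" "f x = f y"
    have "{x} = f x \<inter> S" using f xy(1) by simp
    also have "\<dots> = {y}" using f xy(2,3) by simp
    finally show "x = y" by simp
  qed
  moreover have "countable (f ` S)" using \<B>(1) f by (intro countable_subset[OF _ \<B>(1)]) auto
  ultimately show ?thesis by (rule countable_image_inj_on[rotated])
qed

lemma countable_semi_regular_set_base:
  assumes "discrete (semi_regular_set \<beta> \<Lambda> c)" shows "countable \<Lambda>"
proof -
  have "\<Lambda> \<subseteq> fst ` semi_regular_set \<beta> \<Lambda> c"
    unfolding semi_regular_set_def by (force simp: image_iff)
  then show ?thesis by (rule countable_subset[OF _ countable_image[OF discrete_imp_countable[OF assms]]])
qed

lemma exists_L2_norm_pos: "\<exists>h\<in>L2. L2_norm h > 0"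
proof
  let ?h = "indicator {0..1::real} :: real \<Rightarrow> complex"
  have eq: "(cmod (?h x))\<^sup>2 = indicator {0..1} x" for x by (simp add: indicator_def)
  show "?h \<in> L2" by (simp add: L2_def eq borel_measurable_indicator)
  show "L2_norm ?h > 0" by (simp add: L2_norm_def eq)
qed

text \<open>The admissible constants form a closed set: for fixed \<open>h\<close> the condition on \<open>B\<close> is a non-strict linear
  inequality. The bound \<open>A\<close> keeps the infimum positive.\<close>

lemma upper_bounds_least:
  fixes N :: "'h \<Rightarrow> real" and q :: "'h \<Rightarrow> ennreal" and B0 :: real
  assumes N: "\<And>h. h \<in> H \<Longrightarrow> N h \<ge> 0" and h0: "h0 \<in> H" "N h0 > 0"
    and A: "A > 0" "\<And>h. h \<in> H \<Longrightarrow> ennreal (A * N h) \<le> q h"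
    and ne: "B0 \<in> {B. B > 0 \<and> (\<forall>h\<in>H. q h \<le> ennreal (B * N h))}"
  shows "\<exists>B. is_least_of B {B. B > 0 \<and> (\<forall>h\<in>H. q h \<le> ennreal (B * N h))}"
proof -
  let ?S = "{B. B > 0 \<and> (\<forall>h\<in>H. q h \<le> ennreal (B * N h))}"
  have low: "A \<le> B" if "B \<in> ?S" for B
  proof -
    have "ennreal (A * N h0) \<le> ennreal (B * N h0)" using A(2)[OF h0(1)] that h0(1) by (auto intro: order_trans)
    then show ?thesis using that h0(2) by (simp add: ennreal_le_iff)
  qed
  then have bdd: "bdd_below ?S" by (rule bdd_belowI)
  have AI: "A \<le> Inf ?S" using ne low by (intro cInf_greatest) auto
  have "q h \<le> ennreal (Inf ?S * N h)" if h: "h \<in> H" for h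
  proof -
    have "q h \<le> ennreal (B0 * N h)" using ne h by auto
    then obtain r where r: "r \<ge> 0" "q h = ennreal r" by (cases "q h") (auto simp: top_unique)
    have le: "r \<le> B * N h" if "B \<in> ?S" for B
    proof -
      have "ennreal r \<le> ennreal (B * N h)" using that h by (simp flip: r(2))
      then show ?thesis using that N[OF h] by (simp add: ennreal_le_iff)
    qed
    have "r \<le> Inf ?S * N h"
    proof (cases "N h = 0")
      case True then show ?thesis using le[OF ne] by simp
    next
      case False
      then have "N h > 0" using N[OF h] by simp
      then have "r / N h \<le> Inf ?S" using ne le by (intro cInf_greatest) (auto simp: pos_divide_le_eq)
      then show ?thesis using \<open>N h > 0\<close> by (simp add: pos_divide_le_eq)
    qed
    then show ?thesis unfolding r(2) by (rule ennreal_leI)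
  qed
  then have "Inf ?S \<in> ?S" using AI A(1) by simp
  moreover have "Inf ?S \<le> B" if "B \<in> ?S" for B using that bdd by (rule cInf_lower)
  ultimately show ?thesis unfolding is_least_of_def by blast
qed

lemma lower_bounds_greatest:
  fixes N :: "'h \<Rightarrow> real" and q :: "'h \<Rightarrow> ennreal" and A0 :: real
  assumes N: "\<And>h. h \<in> H \<Longrightarrow> N h \<ge> 0" and h0: "h0 \<in> H" "N h0 > 0"
    and B: "B > 0" "\<And>h. h \<in> H \<Longrightarrow> q h \<le> ennreal (B * N h)"
    and ne: "A0 \<in> {A. A > 0 \<and> (\<forall>h\<in>H. ennreal (A * N h) \<le> q h)}"
  shows "\<exists>A. is_greatest_of A {A. A > 0 \<and> (\<forall>h\<in>H. ennreal (A * N h) \<le> q h)}"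
proof -
  let ?S = "{A. A > 0 \<and> (\<forall>h\<in>H. ennreal (A * N h) \<le> q h)}"
  have up: "A \<le> B" if "A \<in> ?S" for A
  proof -
    have "ennreal (A * N h0) \<le> ennreal (B * N h0)" using B(2)[OF h0(1)] that h0(1) by (auto intro: order_trans)
    then show ?thesis using B(1) h0(2) by (simp add: ennreal_le_iff)
  qed
  then have bdd: "bdd_above ?S" by (rule bdd_aboveI)
  have AS: "A0 \<le> Sup ?S" using ne bdd by (rule cSup_upper)
  have "ennreal (Sup ?S * N h) \<le> q h" if h: "h \<in> H" for h
  proof -
    have "q h \<le> ennreal (B * N h)" using B(2) h by auto
    then obtain r where r: "r \<ge> 0" "q h = ennreal r" by (cases "q h") (auto simp: top_unique)
    have le: "A * N h \<le> r" if "A \<in> ?S" for A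
    proof -
      have "ennreal (A * N h) \<le> ennreal r" using that h by (simp flip: r(2))
      then show ?thesis using r(1) by (simp add: ennreal_le_iff)
    qed
    have "Sup ?S * N h \<le> r"
    proof (cases "N h = 0")
      case True then show ?thesis using r(1) by simp
    next
      case False
      then have "N h > 0" using N[OF h] by simp
      then have "Sup ?S \<le> r / N h" using ne le by (intro cSup_least) (auto simp: pos_le_divide_eq)
      then show ?thesis using \<open>N h > 0\<close> by (simp add: pos_le_divide_eq)
    qed
    then show ?thesis unfolding r(2) by (rule ennreal_leI)
  qed
  moreover have "A0 > 0" using ne by simp
  ultimately have "Sup ?S \<in> ?S" using AS by simp
  moreover have "A \<le> Sup ?S" if "A \<in> ?S" for A using that bdd by (rule cSup_upper)
  ultimately show ?thesis unfolding is_greatest_of_def by blast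
qed

lemma gabor_frame_iff_bounds:
  "gabor_frame g \<Gamma> \<longleftrightarrow> lower_frame_bounds g \<Gamma> \<noteq> {} \<and> upper_frame_bounds g \<Gamma> \<noteq> {}"
  unfolding gabor_frame_def lower_frame_bounds_def upper_frame_bounds_def by blast

text \<open>Positive constants are frame bounds exactly when they are matrix bounds, so the two problems have the
  same optimal constants. For lower bounds, an upper bound supplies the square integrability of the rows in one
  direction and the continuity of the matrices in the other.\<close>

lemma frame_bounds_eq_matrix_bounds:
  assumes "\<beta> > 0" "g \<in> L2" "countable \<Lambda>"
  shows "upper_frame_bounds g (semi_regular_set \<beta> \<Lambda> c) = upper_matrix_bounds \<beta> g \<Lambda> c"
    and "upper_frame_bounds g (semi_regular_set \<beta> \<Lambda> c) \<noteq> {} \<Longrightarrow>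
      lower_frame_bounds g (semi_regular_set \<beta> \<Lambda> c) = lower_matrix_bounds \<beta> g \<Lambda> c"
proof -
  let ?\<Gamma> = "semi_regular_set \<beta> \<Lambda> c"
  show up: "upper_frame_bounds g ?\<Gamma> = upper_matrix_bounds \<beta> g \<Lambda> c"
  proof (intro equalityI subsetI)
    fix B assume "B \<in> upper_frame_bounds g ?\<Gamma>"
    then have B: "B > 0" "\<And>h. h \<in> L2 \<Longrightarrow> ell2_normsq_ext ?\<Gamma> (gabor_coeff g h) \<le> ennreal (B * (L2_norm h)\<^sup>2)"
      by (auto simp: upper_frame_bounds_def)
    have "AE x in lebesgue. \<forall>v\<in>ell2 UNIV. ell2_normsq_ext \<Lambda> (gabor_matrix_apply \<beta> g c x v) \<le> ennreal (B * \<beta> * (ell2_norm UNIV v)\<^sup>2)"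
      using frame_bounds_imp_matrix_bounds[OF assms order_refl less_imp_le[OF B(1)] _ B(2)] by simp
    with B(1) show "B \<in> upper_matrix_bounds \<beta> g \<Lambda> c" by (simp add: upper_matrix_bounds_def)
  qed (rule upper_matrix_bounds_imp_frame[OF assms])
  assume "upper_frame_bounds g ?\<Gamma> \<noteq> {}"
  then obtain B where Bf: "B \<in> upper_frame_bounds g ?\<Gamma>" by blast
  then have B: "B > 0" "\<And>h. h \<in> L2 \<Longrightarrow> ell2_normsq_ext ?\<Gamma> (gabor_coeff g h) \<le> ennreal (B * (L2_norm h)\<^sup>2)"
    by (auto simp: upper_frame_bounds_def)
  show "lower_frame_bounds g ?\<Gamma> = lower_matrix_bounds \<beta> g \<Lambda> c"
  proof (intro equalityI subsetI)
    fix A assume "A \<in> lower_frame_bounds g ?\<Gamma>"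
    then have A: "A > 0" "\<And>h. h \<in> L2 \<Longrightarrow> ennreal (A * (L2_norm h)\<^sup>2) \<le> ell2_normsq_ext ?\<Gamma> (gabor_coeff g h)"
      by (auto simp: lower_frame_bounds_def)
    have "AE x in lebesgue. \<forall>v\<in>ell2 UNIV. ennreal (A * \<beta> * (ell2_norm UNIV v)\<^sup>2) \<le> ell2_normsq_ext \<Lambda> (gabor_matrix_apply \<beta> g c x v)"
      using frame_bounds_imp_matrix_bounds[OF assms less_imp_le[OF A(1)] less_imp_le[OF B(1)] A(2) B(2), simplified]
      by (rule AE_mp) simp
    with A(1) show "A \<in> lower_matrix_bounds \<beta> g \<Lambda> c" by (simp add: lower_matrix_bounds_def)
  next
    fix A assume "A \<in> lower_matrix_bounds \<beta> g \<Lambda> c"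
    with Bf show "A \<in> lower_frame_bounds g ?\<Gamma>"
      unfolding up by (intro lower_matrix_bounds_imp_frame[OF assms])
  qed
qed

lemma matrix_bounds_iff:
  "(\<exists>A B. A > 0 \<and> B > 0 \<and> (AE x in lebesgue. \<forall>v\<in>ell2 (UNIV :: int set).
      ennreal (A * \<beta> * (ell2_norm UNIV v)\<^sup>2) \<le> ell2_normsq_ext \<Lambda> (gabor_matrix_apply \<beta> g c x v) \<and>
      ell2_normsq_ext \<Lambda> (gabor_matrix_apply \<beta> g c x v) \<le> ennreal (B * \<beta> * (ell2_norm UNIV v)\<^sup>2))) \<longleftrightarrow>
   lower_matrix_bounds \<beta> g \<Lambda> c \<noteq> {} \<and> upper_matrix_bounds \<beta> g \<Lambda> c \<noteq> {}"
  unfolding lower_matrix_bounds_def upper_matrix_bounds_def ball_conj_distrib AE_conj_iff by blast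

theorem theorem3p1:
  fixes \<beta> :: real and g :: "real \<Rightarrow> complex" and \<Lambda> :: "real set" and c :: "real \<Rightarrow> real"
    and \<Gamma> :: "(real \<times> real) set"
  assumes "\<beta> > 0"
    and "g \<in> L2"
    and "\<Gamma> = semi_regular_set \<beta> \<Lambda> c"
    and "discrete \<Gamma>"
  shows
    "(gabor_frame g \<Gamma> \<longleftrightarrow>
       (\<exists>A B. A > 0 \<and> B > 0 \<and> (AE x in lebesgue. \<forall>v\<in>ell2 (UNIV :: int set).
          ennreal (A * \<beta> * (ell2_norm UNIV v)\<^sup>2) \<le> ell2_normsq_ext \<Lambda> (gabor_matrix_apply \<beta> g c x v) \<and>
          ell2_normsq_ext \<Lambda> (gabor_matrix_apply \<beta> g c x v) \<le> ennreal (B * \<beta> * (ell2_norm UNIV v)\<^sup>2)))) \<and>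
     (gabor_frame g \<Gamma> \<longrightarrow>
       (\<exists>A B. is_greatest_of A (lower_matrix_bounds \<beta> g \<Lambda> c) \<and>
              is_greatest_of A (lower_frame_bounds g \<Gamma>) \<and>
              is_least_of B (upper_matrix_bounds \<beta> g \<Lambda> c) \<and>
              is_least_of B (upper_frame_bounds g \<Gamma>)))"
proof -
  have cnt: "countable \<Lambda>"
    using assms(3,4) countable_semi_regular_set_base by blast
  note up = frame_bounds_eq_matrix_bounds(1)[OF assms(1,2) cnt, of c, folded assms(3)]
  note low = frame_bounds_eq_matrix_bounds(2)[OF assms(1,2) cnt, of c, folded assms(3)]
  have best: "(\<exists>A. is_greatest_of A (lower_frame_bounds g \<Gamma>)) \<and> (\<exists>B. is_least_of B (upper_frame_bounds g \<Gamma>))"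
    if frame: "gabor_frame g \<Gamma>"
  proof -
    obtain A B where A: "A \<in> lower_frame_bounds g \<Gamma>" and B: "B \<in> upper_frame_bounds g \<Gamma>"
      using frame unfolding gabor_frame_iff_bounds by blast
    obtain h0 where h0: "h0 \<in> L2" "(L2_norm h0)\<^sup>2 > 0" using exists_L2_norm_pos by force
    have A': "A > 0" "\<And>h. h \<in> L2 \<Longrightarrow> ennreal (A * (L2_norm h)\<^sup>2) \<le> ell2_normsq_ext \<Gamma> (gabor_coeff g h)"
      using A by (auto simp: lower_frame_bounds_def)
    have B': "B > 0" "\<And>h. h \<in> L2 \<Longrightarrow> ell2_normsq_ext \<Gamma> (gabor_coeff g h) \<le> ennreal (B * (L2_norm h)\<^sup>2)"
      using B by (auto simp: upper_frame_bounds_def)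
    show ?thesis
      using lower_bounds_greatest[of L2 "\<lambda>h. (L2_norm h)\<^sup>2", OF _ h0 B' A[unfolded lower_frame_bounds_def]]
        upper_bounds_least[of L2 "\<lambda>h. (L2_norm h)\<^sup>2", OF _ h0 A' B[unfolded upper_frame_bounds_def]]
      unfolding lower_frame_bounds_def upper_frame_bounds_def by simp
  qed
  have low': "lower_frame_bounds g \<Gamma> = lower_matrix_bounds \<beta> g \<Lambda> c" if "upper_matrix_bounds \<beta> g \<Lambda> c \<noteq> {}"
    using low that unfolding up .
  have iff: "gabor_frame g \<Gamma> \<longleftrightarrow> lower_matrix_bounds \<beta> g \<Lambda> c \<noteq> {} \<and> upper_matrix_bounds \<beta> g \<Lambda> c \<noteq> {}"
    unfolding gabor_frame_iff_bounds up by (cases "upper_matrix_bounds \<beta> g \<Lambda> c = {}") (simp_all add: low')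
  show ?thesis
    unfolding matrix_bounds_iff
  proof (intro conjI impI)
    assume frame: "gabor_frame g \<Gamma>"
    then have "lower_frame_bounds g \<Gamma> = lower_matrix_bounds \<beta> g \<Lambda> c" using low' unfolding iff by blast
    then show "\<exists>A B. is_greatest_of A (lower_matrix_bounds \<beta> g \<Lambda> c) \<and> is_greatest_of A (lower_frame_bounds g \<Gamma>) \<and>
        is_least_of B (upper_matrix_bounds \<beta> g \<Lambda> c) \<and> is_least_of B (upper_frame_bounds g \<Gamma>)"
      using best[OF frame] unfolding up by simp
  qed (rule iff)
qed

end
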